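(* Let $w\in S_n$ for $n\ge 2$ be Mallows distributed with parameter $q\in(0,\infty)$, and let $\mu$ and $\sigma^2$ denote the mean and variance of $\mathrm{des}(w)+\mathrm{des}(w^{-1})$. Let $Z$ denote a standard normal random variable. Then for all piecewise continuously differentiable functions $h:\mathbf{R}\to\mathbf{R}$, $$\left|\mathbf{E}\, h\!\left(\frac{\mathrm{des}(w)+\mathrm{des}(w^{-1})-\mu}{\sigma}\right)-\mathbf{E}\, h(Z)\right|\le \left(331\|h\|_\infty+167\|h'\|_\infty\max(q^{-1/2},q^{1/2})\right)(n-1)^{-1/2}.$$
   Context: For $w\in S_n$ (a permutation of $[n]=\{1,\dots,n\}$), $l(w)$ is the number of inversions, i.e. pairs $i<j$ in $[n]$ with $w(i)>w(j)$. A random $w\in S_n$ is Mallows distributed with parameter $q\in(0,\infty)$ if $\mathbf{P}(w=w_0)$ is proportional to $q^{l(w_0)}$ for $w_0\in S_n$. The number of descents is $\mathrm{des}(w)=\#\{i\in\{1,\dots,n-1\}: w(i)>w(i+1)\}$. Here $\|\cdot\|_\infty$ is the supremum norm. *)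

theory Defs
  imports "HOL-Probability.Probability" "HOL-Combinatorics.Permutations"
begin

text \<open>
  The symmetric group \<open>S\<^sub>n\<close> is the set of all \<open>v\<close> with \<open>v permutes {1..n}\<close>.
\<close>

definition perm_length :: "nat \<Rightarrow> (nat \<Rightarrow> nat) \<Rightarrow> nat"
  where "perm_length n v = card {(i, j). i \<in> {1..n} \<and> j \<in> {1..n} \<and> i < j \<and> v i > v j}"

definition des :: "nat \<Rightarrow> (nat \<Rightarrow> nat) \<Rightarrow> nat"
  where "des n v = card {i \<in> {1..n - 1}. v i > v (i + 1)}"

text \<open>
  The constant \<open>c\<close> below is the proportionality constant; it is determined by the
  requirement that the probabilities sum to 1.
\<close>

definition mallows_distributed ::
    "'a measure \<Rightarrow> ('a \<Rightarrow> nat \<Rightarrow> nat) \<Rightarrow> nat \<Rightarrow> real \<Rightarrow> bool"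
  where "mallows_distributed M w n q \<longleftrightarrow>
    w \<in> measurable M (count_space {v. v permutes {1..n}}) \<and>
    (\<exists>c. \<forall>v. v permutes {1..n} \<longrightarrow>
       measure M {\<omega> \<in> space M. w \<omega> = v} = c * q ^ perm_length n v)"

text \<open>
  The supremum norm takes the value \<open>\<infinity>\<close> on unbounded functions.
\<close>

definition sup_norm_on :: "real set \<Rightarrow> (real \<Rightarrow> real) \<Rightarrow> ennreal"
  where "sup_norm_on A f = (SUP x\<in>A. ennreal \<bar>f x\<bar>)"

abbreviation sup_norm :: "(real \<Rightarrow> real) \<Rightarrow> ennreal"
  where "sup_norm f \<equiv> sup_norm_on UNIV f"

text \<open>
  A piecewise continuously differentiable function has no derivative at some of its
  breakpoints, so the supremum norm of the derivative ranges over the points at which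
  the derivative exists.
\<close>

abbreviation deriv_sup_norm :: "(real \<Rightarrow> real) \<Rightarrow> ennreal"
  where "deriv_sup_norm f \<equiv> sup_norm_on {x. f differentiable (at x)} (deriv f)"

text \<open>
  The library notion \<open>piecewise_C1_differentiable_on\<close> means continuous, and \<open>C\<^sup>1\<close> off a
  finite set. Asking for it on every compact interval allows a function on the whole
  line to have infinitely many breakpoints, finitely many in each bounded interval.
\<close>

definition piecewise_C1 :: "(real \<Rightarrow> real) \<Rightarrow> bool"
  where "piecewise_C1 f \<longleftrightarrow> (\<forall>a b. f piecewise_C1_differentiable_on {a..b})"

end

theory Submission
  imports Defs "HOL-Combinatorics.Multiset_Permutations" "HOL-Real_Asymp.Real_Asymp"
begin

text \<open>
  Let \<open>Y = des w + des w\<^sup>-\<^sup>1\<close> and \<open>p = q / (1 + q)\<close>. Right multiplication by the adjacent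
  transposition \<open>s\<^sub>i\<close> changes the length by one, which gives
  \<open>E ((D\<^sub>i - p) G) = p E (A\<^sub>i (G (w s\<^sub>i) - G w))\<close> for the descent and ascent indicators
  \<open>D\<^sub>i\<close>, \<open>A\<^sub>i\<close>. Since \<open>Y\<close> is invariant under inversion, summing over \<open>i\<close> yields
  \<open>E ((Y - E Y) G(Y)) = 2 p \<Sum>\<^sub>i E (A\<^sub>i (G (Y + \<Delta>\<^sub>i) - G(Y)))\<close> with \<open>\<bar>\<Delta>\<^sub>i\<bar> \<le> 2\<close>, and Stein's method
  reduces the theorem to a lower bound on \<open>\<sigma>\<^sup>2 = 2 p E U\<close> and an upper bound on the variance
  of \<open>U = \<Sum>\<^sub>i A\<^sub>i \<Delta>\<^sub>i\<close>.

  Each \<open>A\<^sub>i \<Delta>\<^sub>i\<close> is a statistic of the relative order of four consecutive values plus the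
  indicator of \<open>w(i + 1) = w(i) + 1\<close>. The first part is handled by the independence of the
  relative orders on disjoint intervals of positions. For the second, restricting the test for
  values between \<open>w(i)\<close> and \<open>w(i + 1)\<close> to an interval of positions makes two distant
  indicators independent at the cost of increasing them; the increase is estimated by the
  explicit probability \<open>\<beta>(M)\<close>, and the resulting covariance bounds telescope, uniformly in
  \<open>q \<le> 1\<close>. Reversing \<open>w\<close> exchanges \<open>q\<close> and \<open>1 / q\<close>.
\<close>

section \<open>Words weighted by inversions\<close>

text \<open>With \<open>W = (Y - E Y) / \<sigma>\<close> and \<open>f\<close> solving
  \<open>f' x - x * f x = h x - c\<close>, the first-order part of \<open>E (W f(W))\<close> is
  \<open>E (U f'(W)) / E U\<close>. The error is therefore \<open>E (f'(W) (1 - U / E U))\<close>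
  plus a Taylor remainder. The former costs a bound on \<open>f'\<close> in terms of the sup norm of
  \<open>h\<close>, times the fluctuation of \<open>U\<close>; the latter costs the Lipschitz
  constant of \<open>h\<close> and a factor \<open>1 / \<sigma>\<close>. For \<open>q <= 1\<close>
  the mean of \<open>U\<close> is at least of order \<open>n - 1\<close> uniformly, so the variance
  is at least of order \<open>q * (n - 1)\<close>: hence the factor \<open>q powr (- 1 / 2)\<close>.
  The obstacle is the adjacency indicator, which depends on the whole permutation. Only upper bounds
  on covariances are needed, so enlarging the events until they are independent loses nothing
  essential. As \<open>h\<close> is merely Lipschitz, no second derivative of \<open>f\<close> is
  used: the Stein equation itself gives a Lipschitz bound for \<open>f'\<close> growing linearly in
  \<open>|x|\<close>, and \<open>E |W| <= 1\<close> absorbs the growth. The argument yields 192 and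
  165 where the statement has 331 and 167.\<close>

definition qint :: "real \<Rightarrow> nat \<Rightarrow> real"
  where "qint q k = (\<Sum>j<k. q ^ j)"

primrec invs :: "nat list \<Rightarrow> nat" where
  "invs [] = 0"
| "invs (x # xs) = length (filter (\<lambda>y. y < x) xs) + invs xs"

definition wsum :: "real \<Rightarrow> nat set \<Rightarrow> (nat list \<Rightarrow> real) \<Rightarrow> real"
  where "wsum q S F = (\<Sum>xs\<in>permutations_of_set S. q ^ invs xs * F xs)"

definition order_invariant :: "nat \<Rightarrow> (nat list \<Rightarrow> real) \<Rightarrow> bool"
  where "order_invariant k F \<longleftrightarrow>
    (\<forall>f xs. length xs = k \<longrightarrow> strict_mono_on (set xs) f \<longrightarrow> F (map f xs) = F xs)"

lemma order_invariantD:
  "order_invariant k F \<Longrightarrow> length xs = k \<Longrightarrow> strict_mono_on (set xs) f \<Longrightarrow> F (map f xs) = F xs"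
  by (auto simp: order_invariant_def)

lemma invs_map: "strict_mono_on (set xs) f \<Longrightarrow> invs (map f xs) = invs xs"
proof (induction xs)
  case (Cons a xs)
  have "strict_mono_on (set xs) f"
    using Cons.prems by (auto simp: strict_mono_on_def)
  moreover have "filter (\<lambda>y. f y < f a) xs = filter (\<lambda>y. y < a) xs"
    using Cons.prems by (intro filter_cong refl) (auto simp: strict_mono_on_less)
  ultimately show ?case
    using Cons.IH by (simp add: filter_map o_def)
qed simp

lemma invs_append_single: "invs (xs @ [x]) = invs xs + length (filter (\<lambda>y. x < y) xs)"
  by (induction xs) auto

lemma length_filter_permutation:
  assumes "xs \<in> permutations_of_set S"
  shows "length (filter P xs) = card {y \<in> S. P y}"
proof -
  have "distinct xs" "set xs = S"
    using assms by (auto simp: permutations_of_set_def)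
  then show ?thesis
    by (metis distinct_card distinct_filter set_filter)
qed

text \<open>The first letter \<open>x\<close> is inverted with exactly the smaller letters of
  \<open>S\<close>, in whatever order the others follow, so its weight factors out.\<close>

lemma wsum_Cons:
  assumes "finite S" "S \<noteq> {}"
  shows "wsum q S F =
    (\<Sum>x\<in>S. q ^ card {y \<in> S. y < x} * wsum q (S - {x}) (\<lambda>ys. F (x # ys)))"
proof -
  have "wsum q S F = (\<Sum>xs\<in>(\<Union>x\<in>S. (#) x ` permutations_of_set (S - {x})). q ^ invs xs * F xs)"
    using permutations_of_set_nonempty[OF assms(2)] by (simp add: wsum_def)
  also have "\<dots> = (\<Sum>x\<in>S. \<Sum>xs\<in>(#) x ` permutations_of_set (S - {x}). q ^ invs xs * F xs)"
    using assms by (intro sum.UNION_disjoint) auto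
  also have "\<dots> = (\<Sum>x\<in>S. q ^ card {y \<in> S. y < x} * wsum q (S - {x}) (\<lambda>ys. F (x # ys)))"
  proof (intro sum.cong refl)
    fix x assume "x \<in> S"
    have "length (filter (\<lambda>y. y < x) ys) = card {y \<in> S. y < x}"
      if "ys \<in> permutations_of_set (S - {x})" for ys
      unfolding length_filter_permutation[OF that] by (rule arg_cong[where f = card]) auto
    then show "(\<Sum>xs\<in>(#) x ` permutations_of_set (S - {x}). q ^ invs xs * F xs) =
        q ^ card {y \<in> S. y < x} * wsum q (S - {x}) (\<lambda>ys. F (x # ys))"
      by (subst sum.reindex)
        (auto simp: inj_on_def wsum_def sum_distrib_left power_add mult_ac intro!: sum.cong)
  qed
  finally show ?thesis .
qed

lemma permutations_of_set_snoc:
  assumes "S \<noteq> {}"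
  shows "permutations_of_set S = (\<Union>x\<in>S. (\<lambda>ys. ys @ [x]) ` permutations_of_set (S - {x}))"
proof (intro equalityI subsetI)
  fix xs assume xs: "xs \<in> permutations_of_set S"
  then have "xs \<noteq> []"
    using assms by (auto simp: permutations_of_set_def)
  then obtain ys x where "xs = ys @ [x]"
    by (metis rev_exhaust)
  with xs show "xs \<in> (\<Union>x\<in>S. (\<lambda>ys. ys @ [x]) ` permutations_of_set (S - {x}))"
    by (auto simp: permutations_of_set_def)
next
  fix xs assume "xs \<in> (\<Union>x\<in>S. (\<lambda>ys. ys @ [x]) ` permutations_of_set (S - {x}))"
  then obtain x ys where "x \<in> S" "xs = ys @ [x]" "set ys = S - {x}" "distinct ys"
    by (auto simp: permutations_of_set_def)
  then show "xs \<in> permutations_of_set S"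
    by (auto simp: permutations_of_set_def)
qed

text \<open>The last letter is inverted with exactly the larger letters. Peeling at this end serves
  prefixes, as \<open>wsum_Cons\<close> serves suffixes.\<close>

lemma wsum_snoc:
  assumes "finite S" "S \<noteq> {}"
  shows "wsum q S F =
    (\<Sum>x\<in>S. q ^ card {y \<in> S. x < y} * wsum q (S - {x}) (\<lambda>ys. F (ys @ [x])))"
proof -
  have "wsum q S F = (\<Sum>xs\<in>(\<Union>x\<in>S. (\<lambda>ys. ys @ [x]) ` permutations_of_set (S - {x})). q ^ invs xs * F xs)"
    using permutations_of_set_snoc[OF assms(2)] by (simp add: wsum_def)
  also have "\<dots> = (\<Sum>x\<in>S. \<Sum>xs\<in>(\<lambda>ys. ys @ [x]) ` permutations_of_set (S - {x}). q ^ invs xs * F xs)"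
    using assms by (intro sum.UNION_disjoint) auto
  also have "\<dots> = (\<Sum>x\<in>S. q ^ card {y \<in> S. x < y} * wsum q (S - {x}) (\<lambda>ys. F (ys @ [x])))"
  proof (intro sum.cong refl)
    fix x assume "x \<in> S"
    have "length (filter (\<lambda>y. x < y) ys) = card {y \<in> S. x < y}"
      if "ys \<in> permutations_of_set (S - {x})" for ys
      unfolding length_filter_permutation[OF that] by (rule arg_cong[where f = card]) auto
    then show "(\<Sum>xs\<in>(\<lambda>ys. ys @ [x]) ` permutations_of_set (S - {x}). q ^ invs xs * F xs) =
        q ^ card {y \<in> S. x < y} * wsum q (S - {x}) (\<lambda>ys. F (ys @ [x]))"
      by (subst sum.reindex)
        (auto simp: inj_on_def wsum_def sum_distrib_left power_add mult_ac invs_append_single intro!: sum.cong)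
  qed
  finally show ?thesis .
qed

lemma wsum_image:
  assumes "strict_mono_on S f" "order_invariant (card S) F"
  shows "wsum q (f ` S) F = wsum q S F"
proof -
  have inj: "inj_on f S"
    using assms(1) by (rule strict_mono_on_imp_inj_on)
  have "wsum q (f ` S) F = (\<Sum>xs\<in>map f ` permutations_of_set S. q ^ invs xs * F xs)"
    unfolding wsum_def using permutations_of_set_image_inj[OF inj] by simp
  also have "\<dots> = (\<Sum>xs\<in>permutations_of_set S. q ^ invs (map f xs) * F (map f xs))"
    using inj by (subst sum.reindex) (auto simp: inj_on_def permutations_of_set_def intro: map_inj_on)
  also have "\<dots> = wsum q S F"
    unfolding wsum_def
  proof (intro sum.cong refl)
    fix xs assume "xs \<in> permutations_of_set S"
    then have "set xs = S" "length xs = card S"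
      by (auto simp: permutations_of_set_def distinct_card)
    then show "q ^ invs (map f xs) * F (map f xs) = q ^ invs xs * F xs"
      using assms by (simp add: invs_map order_invariantD)
  qed
  finally show ?thesis .
qed

lemma ex_strict_mono_bij_lessThan:
  fixes S :: "nat set"
  assumes "finite S"
  shows "\<exists>f. bij_betw f {..<card S} S \<and> strict_mono_on {..<card S} f"
proof (intro exI conjI)
  let ?xs = "sorted_list_of_set S"
  show "bij_betw ((!) ?xs) {..<card S} S"
    using assms by (intro bij_betw_nth) auto
  show "strict_mono_on {..<card S} ((!) ?xs)"
    using assms by (auto intro!: strict_mono_onI sorted_wrt_nth_less[of "(<)"])
qed

lemma wsum_card:
  assumes "finite S" "order_invariant (card S) F"
  shows "wsum q S F = wsum q {..<card S} F"
proof -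
  obtain f where f: "bij_betw f {..<card S} S" "strict_mono_on {..<card S} f"
    using assms(1) ex_strict_mono_bij_lessThan by blast
  then show ?thesis
    using wsum_image[OF f(2), of F q] assms by (simp add: bij_betw_def)
qed

text \<open>Along the increasing enumeration of \<open>S\<close> the ranks from below run through
  \<open>0, ..., card S - 1\<close>, and the ranks from above through the same numbers
  backwards.\<close>

lemma sum_pow_rank:
  fixes S :: "nat set"
  assumes "finite S"
  shows "(\<Sum>x\<in>S. q ^ card {y \<in> S. y < x}) = qint q (card S)"
    and "(\<Sum>x\<in>S. q ^ card {y \<in> S. x < y}) = qint q (card S)"
proof -
  obtain f where f: "bij_betw f {..<card S} S" "strict_mono_on {..<card S} f"
    using assms ex_strict_mono_bij_lessThan by blast
  have inj: "inj_on f {..<card S}" and im: "S = f ` {..<card S}"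
    using f by (auto simp: bij_betw_def)
  have 1: "card {y \<in> S. y < f j} = j" and 2: "card {y \<in> S. f j < y} = card S - Suc j" if "j < card S" for j
  proof -
    have mem: "y \<in> S \<longleftrightarrow> y \<in> f ` {..<card S}" for y
      using im by simp
    have lt: "f i < f k \<longleftrightarrow> i < k" if "i < card S" "k < card S" for i k
      using strict_mono_on_less[OF f(2)] that by simp
    have "{y \<in> S. y < f j} = f ` {i \<in> {..<card S}. f i < f j}"
      by (auto simp: mem)
    also have "{i \<in> {..<card S}. f i < f j} = {..<j}"
      using lt that by auto
    finally have "card {y \<in> S. y < f j} = card (f ` {..<j})" by simp
    also have "\<dots> = j"
      using that by (subst card_image) (auto intro: inj_on_subset[OF inj])
    finally show "card {y \<in> S. y < f j} = j" .
    have "{y \<in> S. f j < y} = f ` {i \<in> {..<card S}. f j < f i}"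
      by (auto simp: mem)
    also have "{i \<in> {..<card S}. f j < f i} = {j<..<card S}"
      using lt that by auto
    finally have "card {y \<in> S. f j < y} = card (f ` {j<..<card S})" by simp
    also have "\<dots> = card S - Suc j"
      using that by (subst card_image) (auto intro: inj_on_subset[OF inj])
    finally show "card {y \<in> S. f j < y} = card S - Suc j" .
  qed
  have "(\<Sum>x\<in>S. q ^ card {y \<in> S. y < x}) = (\<Sum>j<card S. q ^ card {y \<in> S. y < f j})"
    by (rule sum.reindex_bij_betw[OF f(1), symmetric])
  then show "(\<Sum>x\<in>S. q ^ card {y \<in> S. y < x}) = qint q (card S)"
    using 1 by (simp add: qint_def)
  have "(\<Sum>x\<in>S. q ^ card {y \<in> S. x < y}) = (\<Sum>j<card S. q ^ card {y \<in> S. f j < y})"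
    by (rule sum.reindex_bij_betw[OF f(1), symmetric])
  also have "\<dots> = (\<Sum>j<card S. q ^ (card S - Suc j))"
    using 2 by simp
  finally show "(\<Sum>x\<in>S. q ^ card {y \<in> S. x < y}) = qint q (card S)"
    by (simp add: qint_def sum.nat_diff_reindex)
qed

lemma wsum_const_mult: "wsum q S (\<lambda>xs. c * F xs) = c * wsum q S F"
  by (simp add: wsum_def sum_distrib_left mult_ac)

lemma wsum_cong:
  "(\<And>xs. distinct xs \<Longrightarrow> set xs = S \<Longrightarrow> F xs = G xs) \<Longrightarrow> wsum q S F = wsum q S G"
  by (auto simp: wsum_def permutations_of_set_def intro!: sum.cong)

text \<open>The q-factorial, a product of q-integers; it is the total weight of the words on
  \<open>k\<close> letters.\<close>

definition qfact :: "real \<Rightarrow> nat \<Rightarrow> real"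
  where "qfact q k = (\<Prod>j=1..k. qint q j)"

text \<open>Whichever letter comes first, the rest contributes the same sum by
  \<open>wsum_card\<close>; the weights of the first letter add up to a q-integer.\<close>

lemma wsum_tl:
  assumes "finite S" "card S = Suc k" "order_invariant k F"
  shows "wsum q S (\<lambda>xs. F (tl xs)) = qint q (Suc k) * wsum q {..<k} F"
proof -
  have "wsum q S (\<lambda>xs. F (tl xs)) = (\<Sum>x\<in>S. q ^ card {y \<in> S. y < x} * wsum q {..<k} F)"
    using assms wsum_card[of "S - {_}" F q] by (subst wsum_Cons) auto
  then show ?thesis
    using sum_pow_rank(1)[OF assms(1), of q] assms(2) by (simp add: sum_distrib_right[symmetric])
qed

lemma wsum_butlast:
  assumes "finite S" "card S = Suc k" "order_invariant k F"
  shows "wsum q S (\<lambda>xs. F (butlast xs)) = qint q (Suc k) * wsum q {..<k} F"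
proof -
  have "wsum q S (\<lambda>xs. F (butlast xs)) = (\<Sum>x\<in>S. q ^ card {y \<in> S. x < y} * wsum q {..<k} F)"
    using assms wsum_card[of "S - {_}" F q] by (subst wsum_snoc) auto
  then show ?thesis
    using sum_pow_rank(2)[OF assms(1), of q] assms(2) by (simp add: sum_distrib_right[symmetric])
qed

lemma wsum_one: "finite S \<Longrightarrow> wsum q S (\<lambda>_. 1) = qfact q (card S)"
proof (induction "card S" arbitrary: S)
  case 0
  then show ?case by (simp add: wsum_def qfact_def)
next
  case (Suc k)
  have "order_invariant k (\<lambda>_. 1)"
    by (simp add: order_invariant_def)
  then have "wsum q S (\<lambda>_. 1) = qint q (Suc k) * wsum q {..<k} (\<lambda>_. 1)"
    using wsum_tl[of S k "\<lambda>_. 1" q] Suc.prems Suc.hyps(2) by simp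
  then show ?case
    using Suc.hyps(1)[of "{..<k}"] by (simp add: qfact_def Suc.hyps(2)[symmetric] mult.commute)
qed

lemma qint_pos: "0 < q \<Longrightarrow> 0 < k \<Longrightarrow> 0 < qint q k"
  unfolding qint_def by (intro sum_pos) auto

lemma qfact_pos: "0 < q \<Longrightarrow> 0 < qfact q k"
  unfolding qfact_def by (intro prod_pos) (auto simp: qint_pos)

lemma qfact_Suc: "qfact q (Suc k) = qint q (Suc k) * qfact q k"
  by (simp add: qfact_def mult.commute)

definition lexp :: "real \<Rightarrow> nat set \<Rightarrow> (nat list \<Rightarrow> real) \<Rightarrow> real"
  where "lexp q S F = wsum q S F / qfact q (card S)"

lemma lexp_cong: "(\<And>xs. length xs = card S \<Longrightarrow> F xs = G xs) \<Longrightarrow> lexp q S F = lexp q S G"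
  unfolding lexp_def by (rule arg_cong2[where f = "(/)"], rule wsum_cong) (auto simp: distinct_card)

lemma lexp_butlast:
  assumes "q > 0" "order_invariant k F"
  shows "lexp q {..<Suc k} (\<lambda>xs. F (butlast xs)) = lexp q {..<k} F"
  using wsum_butlast[of "{..<Suc k}" k F q] qint_pos[of q "Suc k"] assms
  by (simp add: lexp_def qfact_Suc)

lemma order_invariant_take:
  assumes "order_invariant m F" "m \<le> k"
  shows "order_invariant k (\<lambda>xs. F (take m xs))"
  unfolding order_invariant_def
proof (intro allI impI)
  fix f :: "nat \<Rightarrow> nat" and xs :: "nat list"
  assume *: "length xs = k" "strict_mono_on (set xs) f"
  from *(2) have "strict_mono_on (set (take m xs)) f"
    by (rule monotone_on_subset) (rule set_take_subset)
  with * assms show "F (take m (map f xs)) = F (take m xs)"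
    by (auto simp: take_map intro!: order_invariantD)
qed

text \<open>The weight of the last letter does not depend on the order of the others, so deleting it
  does not bias their relative order. This is repeated until \<open>m\<close> letters
  remain.\<close>

lemma lexp_prefix:
  assumes "q > 0" "m \<le> k" "order_invariant m F"
  shows "lexp q {..<k} (\<lambda>xs. F (take m xs)) = lexp q {..<m} F"
  using assms(2)
proof (induction k rule: dec_induct)
  case base
  show ?case
    by (rule lexp_cong) simp
next
  case (step k)
  have "order_invariant k (\<lambda>xs. F (take m xs))"
    using assms(3) step by (intro order_invariant_take) auto
  from lexp_butlast[OF assms(1) this]
  have "lexp q {..<Suc k} (\<lambda>xs. F (take m (butlast xs))) = lexp q {..<k} (\<lambda>xs. F (take m xs))" .
  moreover have "lexp q {..<Suc k} (\<lambda>xs. F (take m (butlast xs))) = lexp q {..<Suc k} (\<lambda>xs. F (take m xs))"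
    using step by (intro lexp_cong) (simp add: take_butlast)
  ultimately show ?case using step by simp
qed

text \<open>
  \<open>F\<close> may depend on the actual values in the prefix: given these, the relative order of the
  remaining letters still follows the weighted law on words of length \<open>card S - m\<close>.
\<close>

lemma wsum_take_drop:
  assumes "q > 0" "finite S" "m \<le> card S" "order_invariant (card S - m) G"
  shows "wsum q S (\<lambda>xs. F (take m xs) * G (drop m xs)) =
    wsum q S (\<lambda>xs. F (take m xs)) * lexp q {..<card S - m} G"
  using assms(2-)
proof (induction m arbitrary: S F)
  case 0
  then have "wsum q S G = lexp q {..<card S} G * qfact q (card S)"
    using wsum_card[of S G q] qfact_pos[OF assms(1), of "card S"] by (simp add: lexp_def)
  then show ?case
    using wsum_one[OF 0(1), of q] wsum_const_mult[of q S "F []" G]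
      wsum_const_mult[of q S "F []" "\<lambda>_. 1"] by simp
next
  case (Suc m)
  have ne: "S \<noteq> {}" using Suc.prems by auto
  have "wsum q (S - {x}) (\<lambda>ys. F (x # take m ys) * G (drop m ys)) =
      wsum q (S - {x}) (\<lambda>ys. F (x # take m ys)) * lexp q {..<card S - Suc m} G" if "x \<in> S" for x
    using Suc.IH[of "S - {x}" "\<lambda>zs. F (x # zs)"] Suc.prems that by auto
  then show ?case
    unfolding wsum_Cons[OF Suc.prems(1) ne] by (simp add: sum_distrib_right mult.assoc)
qed

lemma lexp_take_drop:
  assumes "q > 0" "finite S" "m \<le> card S" "order_invariant (card S - m) G"
  shows "lexp q S (\<lambda>xs. F (take m xs) * G (drop m xs)) =
    lexp q S (\<lambda>xs. F (take m xs)) * lexp q {..<card S - m} G"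
  using wsum_take_drop[OF assms, of F] by (simp add: lexp_def)

lemma lexp_drop:
  assumes "q > 0" "finite S" "m \<le> card S" "order_invariant (card S - m) G"
  shows "lexp q S (\<lambda>xs. G (drop m xs)) = lexp q {..<card S - m} G"
  using lexp_take_drop[OF assms, of "\<lambda>_. 1"] wsum_one[OF assms(2), of q] qfact_pos[OF assms(1), of "card S"]
  by (simp add: lexp_def)

section \<open>Mallows expectations and adjacent transpositions\<close>

definition inv_pairs :: "nat \<Rightarrow> (nat \<Rightarrow> nat) \<Rightarrow> (nat \<times> nat) set"
  where "inv_pairs n v = {(i, j). i \<in> {1..n} \<and> j \<in> {1..n} \<and> i < j \<and> v i > v j}"

lemma perm_length_inv_pairs: "perm_length n v = card (inv_pairs n v)"
  by (simp add: perm_length_def inv_pairs_def)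

lemma finite_inv_pairs [simp]: "finite (inv_pairs n v)"
  by (rule finite_subset[of _ "{1..n} \<times> {1..n}"]) (auto simp: inv_pairs_def)

lemma permutes_less_iff:
  "v permutes S \<Longrightarrow> v i < v j \<longleftrightarrow> \<not> v j < v i \<and> i \<noteq> j" for v :: "nat \<Rightarrow> nat"
  by (metis linorder_less_linear less_asym permutes_inj injD)

text \<open>Apart from the pair \<open>(i, i + 1)\<close>, which becomes an inversion, the
  transposition keeps the order of every pair of positions and so carries inversions bijectively to
  inversions.\<close>

lemma perm_length_swap:
  assumes v: "v permutes {1..n}" and i: "i \<in> {1..n - 1}" and asc: "v i < v (i + 1)"
  shows "perm_length n (v \<circ> Transposition.transpose i (i + 1)) = perm_length n v + 1"
proof -
  let ?s = "Transposition.transpose i (i + 1)"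
  have "inv_pairs n (v \<circ> ?s) = insert (i, i + 1) (map_prod ?s ?s ` inv_pairs n v)"
  proof (intro equalityI subsetI)
    fix x assume x: "x \<in> inv_pairs n (v \<circ> ?s)"
    then obtain a b where ab: "x = (a, b)" "a \<in> {1..n}" "b \<in> {1..n}" "a < b" "v (?s a) > v (?s b)"
      by (auto simp: inv_pairs_def)
    show "x \<in> insert (i, i + 1) (map_prod ?s ?s ` inv_pairs n v)"
    proof (cases "x = (i, i + 1)")
      case False
      have "(?s a, ?s b) \<in> inv_pairs n v"
        using ab False i by (auto simp: inv_pairs_def Transposition.transpose_def split: if_splits)
      moreover have "x = map_prod ?s ?s (?s a, ?s b)"
        using ab by simp
      ultimately show ?thesis by blast
    qed simp
  next
    fix x assume x: "x \<in> insert (i, i + 1) (map_prod ?s ?s ` inv_pairs n v)"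
    show "x \<in> inv_pairs n (v \<circ> ?s)"
    proof (cases "x = (i, i + 1)")
      case True
      then show ?thesis using asc i by (auto simp: inv_pairs_def)
    next
      case False
      with x obtain a b where ab: "x = (?s a, ?s b)" "a \<in> {1..n}" "b \<in> {1..n}" "a < b" "v a > v b"
        by (auto simp: inv_pairs_def)
      then have "(a, b) \<noteq> (i, i + 1)"
        using asc by auto
      with ab i show ?thesis
        by (auto simp: inv_pairs_def Transposition.transpose_def split: if_splits)
    qed
  qed
  moreover have "(i, i + 1) \<notin> map_prod ?s ?s ` inv_pairs n v"
  proof
    assume "(i, i + 1) \<in> map_prod ?s ?s ` inv_pairs n v"
    then obtain x where "x \<in> inv_pairs n v" "map_prod ?s ?s x = (i, i + 1)"
      by (auto elim!: imageE)
    then obtain a b where "?s a = i" "?s b = i + 1" "a < b"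
      by (cases x) (auto simp: inv_pairs_def)
    then show False
      by (auto simp: Transposition.transpose_def split: if_splits)
  qed
  moreover have "card (map_prod ?s ?s ` inv_pairs n v) = card (inv_pairs n v)"
    by (rule card_image) (auto intro!: inj_onI dest: injD[OF inj_on_transpose])
  ultimately show ?thesis
    by (simp add: perm_length_inv_pairs)
qed

lemma perm_length_inv:
  assumes v: "v permutes {1..n}"
  shows "perm_length n (inv v) = perm_length n v"
proof -
  have "bij_betw (\<lambda>(i, j). (v j, v i)) (inv_pairs n v) (inv_pairs n (inv v))"
    by (rule bij_betw_byWitness[where f' = "\<lambda>(i, j). (inv v j, inv v i)"])
      (use permutes_in_image[OF v] permutes_in_image[OF permutes_inv[OF v]] permutes_inverses[OF v]
        in \<open>auto simp: inv_pairs_def simp del: atLeastAtMost_iff\<close>)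
  then show ?thesis
    by (simp add: perm_length_inv_pairs bij_betw_same_card)
qed

text \<open>The identity outside \<open>{1..n}\<close> makes the reversal a permutation in the sense
  of \<open>permutes\<close>.\<close>

definition flip :: "nat \<Rightarrow> nat \<Rightarrow> nat"
  where "flip n i = (if i \<in> {1..n} then n + 1 - i else i)"

lemma flip_flip [simp]: "flip n (flip n i) = i"
  by (auto simp: flip_def)

lemma flip_mem: "flip n i \<in> {1..n} \<longleftrightarrow> i \<in> {1..n}"
  by (auto simp: flip_def)

lemma flip_permutes: "flip n permutes {1..n}"
  unfolding permutes_def by (metis flip_flip flip_def)

lemma flip_less: "i \<in> {1..n} \<Longrightarrow> j \<in> {1..n} \<Longrightarrow> flip n i < flip n j \<longleftrightarrow> j < i"
  by (auto simp: flip_def)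

text \<open>Reversing both positions and values preserves inversions. This later turns windows to
  the right of a position into windows to its left.\<close>

lemma perm_length_flip_flip:
  assumes v: "v permutes {1..n}"
  shows "perm_length n (flip n \<circ> v \<circ> flip n) = perm_length n v"
proof -
  have "bij_betw (\<lambda>(i, j). (flip n j, flip n i)) (inv_pairs n v) (inv_pairs n (flip n \<circ> v \<circ> flip n))"
    by (rule bij_betw_byWitness[where f' = "\<lambda>(i, j). (flip n j, flip n i)"])
      (use permutes_in_image[OF v] flip_mem[of n] flip_less[of _ n]
        in \<open>auto simp: inv_pairs_def simp del: atLeastAtMost_iff\<close>)
  then show ?thesis
    by (simp add: perm_length_inv_pairs bij_betw_same_card)
qed

text \<open>Reversing positions exchanges inversions and non-inversions. The constant sum is the
  reason why reversal replaces \<open>q\<close> by \<open>1 / q\<close>.\<close>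

lemma perm_length_flip:
  assumes v: "v permutes {1..n}"
  shows "perm_length n (v \<circ> flip n) + perm_length n v = card {(i, j). i \<in> {1..n} \<and> j \<in> {1..n} \<and> i < j}"
proof -
  let ?P = "{(i, j). i \<in> {1..n} \<and> j \<in> {1..n} \<and> i < j}"
  have fin: "finite ?P"
    by (rule finite_subset[of _ "{1..n} \<times> {1..n}"]) auto
  have lt: "v i < v j" if "i < j" "\<not> v j < v i" for i j
    using permutes_less_iff[OF v, of i j] that by simp
  have "bij_betw (\<lambda>(i, j). (flip n j, flip n i)) (?P - inv_pairs n v) (inv_pairs n (v \<circ> flip n))"
    by (rule bij_betw_byWitness[where f' = "\<lambda>(i, j). (flip n j, flip n i)"])
      (use permutes_in_image[OF v] flip_mem[of n] flip_less[of _ n] lt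
        in \<open>auto simp: inv_pairs_def simp del: atLeastAtMost_iff dest: less_asym\<close>)
  then have "perm_length n (v \<circ> flip n) = card (?P - inv_pairs n v)"
    by (simp add: perm_length_inv_pairs bij_betw_same_card)
  also have "\<dots> = card ?P - perm_length n v"
    unfolding perm_length_inv_pairs
    by (rule card_Diff_subset[OF finite_inv_pairs]) (auto simp: inv_pairs_def)
  moreover have "perm_length n v \<le> card ?P"
    unfolding perm_length_inv_pairs by (rule card_mono[OF fin]) (auto simp: inv_pairs_def)
  ultimately show ?thesis by simp
qed

text \<open>A finite sum, free of any probability space;
  \<open>mallows_distributed_expectation\<close> makes the link to a given one.\<close>

definition mallows_E :: "nat \<Rightarrow> real \<Rightarrow> ((nat \<Rightarrow> nat) \<Rightarrow> real) \<Rightarrow> real"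
  where "mallows_E n q F = (\<Sum>v | v permutes {1..n}. q ^ perm_length n v * F v) /
    (\<Sum>v | v permutes {1..n}. q ^ perm_length n v)"

locale mallows =
  fixes n :: nat and q :: real
  assumes n: "n \<ge> 2" and q: "q > 0"
begin

abbreviation "E \<equiv> mallows_E n q"

lemma finite_perms [simp]: "finite {v. v permutes {1..n}}"
  by (simp add: finite_permutations)

lemma total_pos: "(\<Sum>v | v permutes {1..n}. q ^ perm_length n v) > 0"
proof (rule sum_pos)
  show "{v. v permutes {1..n}} \<noteq> {}"
    using permutes_id[of "{1..n}"] by blast
qed (use q in \<open>auto simp: finite_permutations\<close>)

lemma E_cong: "(\<And>v. v permutes {1..n} \<Longrightarrow> F v = G v) \<Longrightarrow> E F = E G"
  by (auto simp: mallows_E_def intro!: sum.cong arg_cong2[where f = "(/)"])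

lemma E_add: "E (\<lambda>v. F v + G v) = E F + E G"
  by (simp add: mallows_E_def sum.distrib distrib_left add_divide_distrib)

lemma E_cmult: "E (\<lambda>v. c * F v) = c * E F"
  by (simp add: mallows_E_def sum_distrib_left mult_ac)

lemma E_diff: "E (\<lambda>v. F v - G v) = E F - E G"
  by (simp add: mallows_E_def sum_subtractf right_diff_distrib diff_divide_distrib)

lemma E_const [simp]: "E (\<lambda>_. c) = c"
  using total_pos by (simp add: mallows_E_def sum_distrib_right[symmetric])

lemma E_sum: "E (\<lambda>v. \<Sum>i\<in>I. F i v) = (\<Sum>i\<in>I. E (F i))"
proof (induction I rule: infinite_finite_induct)
  case (insert i I)
  then show ?case by (simp add: E_add)
qed auto

lemma E_mono: "(\<And>v. v permutes {1..n} \<Longrightarrow> F v \<le> G v) \<Longrightarrow> E F \<le> E G"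
  unfolding mallows_E_def using q total_pos
  by (intro divide_right_mono sum_mono mult_left_mono) auto

lemma E_abs: "\<bar>E F\<bar> \<le> E (\<lambda>v. \<bar>F v\<bar>)"
proof -
  have "E F \<le> E (\<lambda>v. \<bar>F v\<bar>)" "E (\<lambda>v. -1 * F v) \<le> E (\<lambda>v. \<bar>F v\<bar>)"
    by (auto intro!: E_mono)
  then show ?thesis
    unfolding E_cmult by linarith
qed

text \<open>The variance of \<open>|F|\<close> is nonnegative.\<close>

lemma E_abs_le_sqrt: "E (\<lambda>v. \<bar>F v\<bar>) \<le> sqrt (E (\<lambda>v. (F v)\<^sup>2))"
proof -
  let ?m = "E (\<lambda>v. \<bar>F v\<bar>)"
  have "0 \<le> E (\<lambda>v. (\<bar>F v\<bar> - ?m)\<^sup>2)"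
    using E_mono[of "\<lambda>_. 0"] by simp
  also have "(\<lambda>v. (\<bar>F v\<bar> - ?m)\<^sup>2) = (\<lambda>v. (F v)\<^sup>2 - (2 * ?m) * \<bar>F v\<bar> + ?m\<^sup>2)"
    by (auto simp: power2_eq_square algebra_simps)
  also have "E \<dots> = E (\<lambda>v. (F v)\<^sup>2) - ?m\<^sup>2"
    by (subst E_add, subst E_diff, subst E_cmult) (simp add: power2_eq_square)
  finally show ?thesis
    by (intro real_le_rsqrt) simp
qed

lemma E_inv: "E (\<lambda>v. F (inv v)) = E F"
proof -
  have "(\<Sum>v | v permutes {1..n}. q ^ perm_length n v * F v) =
      (\<Sum>v | v permutes {1..n}. q ^ perm_length n v * F (inv v))"
    by (rule sum.reindex_bij_witness[of _ inv inv])
      (auto simp: permutes_inv permutes_inv_inv perm_length_inv)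
  then show ?thesis by (simp add: mallows_E_def)
qed

lemma E_flip_flip: "E (\<lambda>v. F (flip n \<circ> v \<circ> flip n)) = E F"
proof -
  have ff: "flip n \<circ> (flip n \<circ> v \<circ> flip n) \<circ> flip n = v" for v
    by (rule ext) simp
  have "(\<Sum>v | v permutes {1..n}. q ^ perm_length n v * F v) =
      (\<Sum>v | v permutes {1..n}. q ^ perm_length n v * F (flip n \<circ> v \<circ> flip n))"
    by (rule sum.reindex_bij_witness[of _ "\<lambda>v. flip n \<circ> v \<circ> flip n" "\<lambda>v. flip n \<circ> v \<circ> flip n"])
      (use perm_length_flip_flip[of _ n] ff in
        \<open>auto simp del: One_nat_def intro!: permutes_compose flip_permutes\<close>)
  then show ?thesis by (simp add: mallows_E_def)
qed

lemma E_flip: "mallows_E n (1 / q) (\<lambda>v. F (v \<circ> flip n)) = E F"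
proof -
  let ?C = "card {(i, j). i \<in> {1..n} \<and> j \<in> {1..n} \<and> i < j}"
  have ff: "v \<circ> flip n \<circ> flip n = v" for v :: "nat \<Rightarrow> nat"
    by (rule ext) simp
  have len: "q ^ perm_length n v = q ^ ?C * (1 / q) ^ perm_length n (v \<circ> flip n)" if "v permutes {1..n}" for v
    unfolding perm_length_flip[OF that, symmetric] using q
    by (simp add: power_add power_divide)
  have "(\<Sum>v | v permutes {1..n}. q ^ perm_length n v * G v) =
      q ^ ?C * (\<Sum>v | v permutes {1..n}. (1 / q) ^ perm_length n v * G (v \<circ> flip n))" for G
    unfolding sum_distrib_left
    by (rule sum.reindex_bij_witness[of _ "\<lambda>v. v \<circ> flip n" "\<lambda>v. v \<circ> flip n"])
      (use ff len in \<open>auto simp del: One_nat_def intro!: permutes_compose flip_permutes\<close>)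
  from this[of F] this[of "\<lambda>_. 1"] show ?thesis
    using q by (simp add: mallows_E_def)
qed

definition asc :: "nat \<Rightarrow> (nat \<Rightarrow> nat) \<Rightarrow> real"
  where "asc i v = of_bool (v i < v (i + 1))"

definition dsc :: "nat \<Rightarrow> (nat \<Rightarrow> nat) \<Rightarrow> real"
  where "dsc i v = of_bool (v (i + 1) < v i)"

lemma asc_dsc: "v permutes {1..n} \<Longrightarrow> asc i v = 1 - dsc i v"
  using permutes_less_iff[of v "{1..n}" i "i + 1"] by (simp add: asc_def dsc_def)

abbreviation swap :: "nat \<Rightarrow> (nat \<Rightarrow> nat) \<Rightarrow> nat \<Rightarrow> nat"
  where "swap i v \<equiv> v \<circ> Transposition.transpose i (i + 1)"

text \<open>The swap matches the permutations descending at \<open>i\<close> with those ascending at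
  \<open>i\<close>, the former having one inversion more.\<close>

lemma E_swap:
  assumes "i \<in> {1..n - 1}"
  shows "E (\<lambda>v. dsc i v * G v) = q * E (\<lambda>v. asc i v * G (swap i v))"
proof -
  have ss: "swap i (swap i v) = v" for v
    by (rule ext) simp
  have per: "swap i v permutes {1..n}" if "v permutes {1..n}" for v
    using that assms by (intro permutes_compose permutes_swap_id) auto
  have "(\<Sum>v | v permutes {1..n}. q ^ perm_length n v * (dsc i v * G v)) =
      (\<Sum>v | v permutes {1..n}. q * (q ^ perm_length n v * (asc i v * G (swap i v))))"
  proof (rule sum.reindex_bij_witness[of _ "swap i" "swap i"])
    fix v assume "v \<in> {v. v permutes {1..n}}"
    then have v: "v permutes {1..n}" by simp
    have "perm_length n v = perm_length n (swap i v) + 1" if "v (i + 1) < v i"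
      using perm_length_swap[OF per[OF v] assms] that unfolding ss by simp
    then show "q * (q ^ perm_length n (swap i v) * (asc i (swap i v) * G (swap i (swap i v)))) =
        q ^ perm_length n v * (dsc i v * G v)"
      unfolding ss by (auto simp: asc_def dsc_def)
  qed (use ss per in auto)
  then show ?thesis
    by (simp add: mallows_E_def sum_distrib_left)
qed

definition "p = q / (1 + q)"

text \<open>Once the descent part is rewritten by \<open>E_swap\<close>, this is the identity
  \<open>(1 - p) * q = p\<close>.\<close>

lemma E_dsc_centered:
  assumes "i \<in> {1..n - 1}"
  shows "E (\<lambda>v. (dsc i v - p) * G v) = p * E (\<lambda>v. asc i v * (G (swap i v) - G v))"
proof -
  have "E G = E (\<lambda>v. dsc i v * G v) + E (\<lambda>v. asc i v * G v)"
    unfolding E_add[symmetric] by (rule E_cong) (simp add: asc_dsc algebra_simps)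
  moreover have "E (\<lambda>v. (dsc i v - p) * G v) = E (\<lambda>v. dsc i v * G v) - p * E G"
    by (simp add: left_diff_distrib E_diff E_cmult)
  moreover have "E (\<lambda>v. asc i v * (G (swap i v) - G v)) =
      E (\<lambda>v. asc i v * G (swap i v)) - E (\<lambda>v. asc i v * G v)"
    by (simp add: right_diff_distrib E_diff)
  moreover have "p * (1 + q) = q" "1 + q \<noteq> 0"
    using q by (simp_all add: p_def)
  ultimately show ?thesis
    using E_swap[OF assms, of G] by algebra
qed

lemma E_dsc: "i \<in> {1..n - 1} \<Longrightarrow> E (dsc i) = p"
  using E_dsc_centered[of i "\<lambda>_. 1"] by (simp add: E_diff)

end

section \<open>Independence of relative orders\<close>

lemma invs_card: "invs xs = card {(i, j). i < j \<and> j < length xs \<and> xs ! j < xs ! i}"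
proof (induction xs)
  case (Cons x xs)
  let ?P = "\<lambda>xs. {(i, j). i < j \<and> j < length xs \<and> xs ! j < xs ! i}"
  have fin: "finite (?P xs)"
    by (rule finite_subset[of _ "{..<length xs} \<times> {..<length xs}"]) auto
  have "?P (x # xs) = (\<lambda>j. (0, Suc j)) ` {j. j < length xs \<and> xs ! j < x} \<union> map_prod Suc Suc ` ?P xs"
  proof (intro equalityI subsetI)
    fix y assume "y \<in> ?P (x # xs)"
    then obtain i j where "y = (i, Suc j)" "i < Suc j" "j < length xs" "xs ! j < (x # xs) ! i"
      by (auto simp: less_Suc_eq_0_disj nth_Cons')
    then show "y \<in> (\<lambda>j. (0, Suc j)) ` {j. j < length xs \<and> xs ! j < x} \<union> map_prod Suc Suc ` ?P xs"
      by (cases i) auto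
  qed auto
  moreover have "card ((\<lambda>j. (0::nat, Suc j)) ` {j. j < length xs \<and> xs ! j < x}) = length (filter (\<lambda>y. y < x) xs)"
    unfolding length_filter_conv_card by (rule card_image) (auto simp: inj_on_def)
  moreover have "card (map_prod Suc Suc ` ?P xs) = invs xs"
    unfolding Cons.IH by (rule card_image) (auto simp: inj_on_def)
  moreover have "(\<lambda>j. (0, Suc j)) ` {j. j < length xs \<and> xs ! j < x} \<inter> map_prod Suc Suc ` ?P xs = {}"
    by auto
  ultimately show ?case
    using fin by (simp add: card_Un_disjoint)
qed simp

text \<open>Positions count from 1 and list indices from 0; beyond the list stands the identity, as
  \<open>permutes\<close> requires.\<close>

definition of_list :: "nat list \<Rightarrow> nat \<Rightarrow> nat"
  where "of_list xs i = (if i \<in> {1..length xs} then xs ! (i - 1) else i)"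

definition to_list :: "nat \<Rightarrow> (nat \<Rightarrow> nat) \<Rightarrow> nat list"
  where "to_list n v = map v [1..<Suc n]"

lemma length_to_list [simp]: "length (to_list n v) = n"
  by (simp add: to_list_def)

lemma nth_to_list: "i < n \<Longrightarrow> to_list n v ! i = v (Suc i)"
  unfolding to_list_def by (subst nth_map) (auto simp del: upt_Suc)

lemma bij_betw_to_list: "bij_betw (to_list n) {v. v permutes {1..n}} (permutations_of_set {1..n})"
proof (rule bij_betw_byWitness[where f' = of_list])
  show "\<forall>v\<in>{v. v permutes {1..n}}. of_list (to_list n v) = v"
  proof (intro ballI ext)
    fix v i assume "v \<in> {v. v permutes {1..n}}"
    then show "of_list (to_list n v) i = v i"
      using permutes_not_in[of v "{1..n}" i] by (auto simp: of_list_def nth_to_list)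
  qed
  show "\<forall>xs\<in>permutations_of_set {1..n}. to_list n (of_list xs) = xs"
    by (auto simp: permutations_of_set_def of_list_def nth_to_list intro!: nth_equalityI
        dest!: distinct_card)
  show "to_list n ` {v. v permutes {1..n}} \<subseteq> permutations_of_set {1..n}"
  proof safe
    fix v assume v: "v permutes {1..n}"
    have "set [1..<Suc n] = {1..n}" by auto
    then show "to_list n v \<in> permutations_of_set {1..n}"
      using permutes_image[OF v] permutes_inj_on[OF v]
      by (simp add: permutations_of_set_def to_list_def distinct_map del: upt_Suc)
  qed
  show "of_list ` permutations_of_set {1..n} \<subseteq> {v. v permutes {1..n}}"
  proof safe
    fix xs assume "xs \<in> permutations_of_set {1..n}"
    then have xs: "distinct xs" "set xs = {1..n}" "length xs = n"
      by (auto simp: permutations_of_set_def dest!: distinct_card)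
    have "inj_on (of_list xs) {1..n}"
    proof (rule inj_onI)
      fix i j assume ij: "i \<in> {1..n}" "j \<in> {1..n}" "of_list xs i = of_list xs j"
      then have "xs ! (i - 1) = xs ! (j - 1)"
        using xs by (simp add: of_list_def)
      then have "i - 1 = j - 1"
        using xs ij by (subst (asm) nth_eq_iff_index_eq) auto
      then show "i = j" using ij by auto
    qed
    moreover have "of_list xs ` {1..n} \<subseteq> {1..n}"
    proof safe
      fix i assume "i \<in> {1..n}"
      then have "of_list xs i = xs ! (i - 1)" "i - 1 < length xs"
        using xs by (auto simp: of_list_def)
      then show "of_list xs i \<in> {1..n}"
        using xs nth_mem by metis
    qed
    ultimately have "bij_betw (of_list xs) {1..n} {1..n}"
      by (simp add: bij_betw_def endo_inj_surj)
    then show "of_list xs permutes {1..n}"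
      by (rule bij_imp_permutes) (use xs in \<open>auto simp: of_list_def\<close>)
  qed
qed

lemma invs_to_list: "invs (to_list n v) = perm_length n v"
proof -
  have "bij_betw (map_prod Suc Suc) {(i, j). i < j \<and> j < n \<and> v (Suc j) < v (Suc i)} (inv_pairs n v)"
    by (rule bij_betw_byWitness[where f' = "map_prod (\<lambda>i. i - 1) (\<lambda>i. i - 1)"])
      (auto simp: inv_pairs_def)
  moreover have "{(i, j). i < j \<and> j < n \<and> to_list n v ! j < to_list n v ! i} =
      {(i, j). i < j \<and> j < n \<and> v (Suc j) < v (Suc i)}"
    by (auto simp: nth_to_list)
  ultimately show ?thesis
    by (simp add: invs_card perm_length_inv_pairs bij_betw_same_card)
qed

text \<open>Here \<open>u\<close> and \<open>v\<close> range over all functions, not only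
  permutations, so that \<open>F\<close> can also be evaluated at the entries of a list.\<close>

definition depends_on :: "nat set \<Rightarrow> ((nat \<Rightarrow> nat) \<Rightarrow> real) \<Rightarrow> bool"
  where "depends_on W F \<longleftrightarrow>
    (\<forall>u v. (\<forall>j\<in>W. \<forall>k\<in>W. u j < u k \<longleftrightarrow> v j < v k) \<longrightarrow> F u = F v)"

lemma depends_onD:
  "depends_on W F \<Longrightarrow> (\<And>j k. j \<in> W \<Longrightarrow> k \<in> W \<Longrightarrow> u j < u k \<longleftrightarrow> v j < v k) \<Longrightarrow> F u = F v"
  unfolding depends_on_def by blast

lemma order_invariant_depends_on:
  assumes "depends_on {s..t} F"
  shows "order_invariant (t + 1 - s) (\<lambda>zs. F (\<lambda>i. zs ! (i - s)))"
  unfolding order_invariant_def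
proof (intro allI impI)
  fix f :: "nat \<Rightarrow> nat" and zs :: "nat list"
  assume *: "length zs = t + 1 - s" "strict_mono_on (set zs) f"
  show "F (\<lambda>i. map f zs ! (i - s)) = F (\<lambda>i. zs ! (i - s))"
    by (rule depends_onD[OF assms]) (use * in \<open>auto simp: strict_mono_on_less\<close>)
qed

context mallows
begin

lemma E_lexp: "E F = lexp q {1..n} (\<lambda>xs. F (of_list xs))"
proof -
  have *: "wsum q {1..n} (\<lambda>xs. F (of_list xs)) = (\<Sum>v | v permutes {1..n}. q ^ perm_length n v * F v)" for F
  proof -
    have "of_list (to_list n v) = v" if "v permutes {1..n}" for v
      using permutes_not_in[OF that] by (auto simp: of_list_def nth_to_list fun_eq_iff)
    then have "(\<Sum>v | v permutes {1..n}. q ^ perm_length n v * F v) =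
      (\<Sum>v | v permutes {1..n}. q ^ invs (to_list n v) * F (of_list (to_list n v)))"
      by (intro sum.cong) (auto simp: invs_to_list)
    also have "\<dots> = wsum q {1..n} (\<lambda>xs. F (of_list xs))"
      unfolding wsum_def by (rule sum.reindex_bij_betw[OF bij_betw_to_list])
    finally show ?thesis by simp
  qed
  from *[of F] *[of "\<lambda>_. 1"] wsum_one[of "{1..n}" q] show ?thesis
    by (simp add: mallows_E_def lexp_def)
qed

text \<open>A window of consecutive positions carries the same kind of weighted law:
  \<open>lexp_drop\<close> removes the letters before \<open>s\<close>, \<open>lexp_prefix\<close>
  those after \<open>t\<close>.\<close>

lemma E_window:
  assumes "depends_on {s..t} F" "1 \<le> s" "s \<le> t" "t \<le> n"
  shows "E F = lexp q {..<t + 1 - s} (\<lambda>zs. F (\<lambda>i. zs ! (i - s)))"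
proof -
  let ?G = "\<lambda>zs. F (\<lambda>i. zs ! (i - s))"
  have oi: "order_invariant (n - (s - 1)) (\<lambda>zs. ?G (take (t + 1 - s) zs))"
    using assms by (intro order_invariant_take order_invariant_depends_on) auto
  have "E F = lexp q {1..n} (\<lambda>xs. ?G (take (t + 1 - s) (drop (s - 1) xs)))"
    unfolding E_lexp
    by (intro lexp_cong depends_onD[OF assms(1)]) (use assms in \<open>auto simp: of_list_def\<close>)
  also have "\<dots> = lexp q {..<card {1..n} - (s - 1)} (\<lambda>zs. ?G (take (t + 1 - s) zs))"
    using oi assms by (intro lexp_drop[OF q]) auto
  also have "\<dots> = lexp q {..<t + 1 - s} ?G"
    using assms by (intro lexp_prefix[OF q] order_invariant_depends_on) auto
  finally show ?thesis .
qed

text \<open>By \<open>lexp_take_drop\<close>, the relative order of the later letters has the same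
  law whatever letters occupy the first \<open>m\<close> places.\<close>

lemma E_indep:
  assumes "depends_on {1..m} F" "depends_on {m + 1..n} G" "m \<le> n"
  shows "E (\<lambda>v. F v * G v) = E F * E G"
proof -
  let ?F = "\<lambda>zs. F (\<lambda>i. zs ! (i - 1))" and ?G = "\<lambda>zs. G (\<lambda>i. zs ! (i - (m + 1)))"
  have oi: "order_invariant (card {1..n} - m) ?G"
    using order_invariant_depends_on[OF assms(2)] assms(3) by simp
  have F: "F (of_list xs) = ?F (take m xs)" if "length xs = card {1..n}" for xs
    by (rule depends_onD[OF assms(1)]) (use assms that in \<open>auto simp: of_list_def\<close>)
  have G: "G (of_list xs) = ?G (drop m xs)" if "length xs = card {1..n}" for xs
    by (rule depends_onD[OF assms(2)]) (use assms that in \<open>auto simp: of_list_def\<close>)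
  have "E (\<lambda>v. F v * G v) = lexp q {1..n} (\<lambda>xs. ?F (take m xs) * ?G (drop m xs))"
    unfolding E_lexp using F G by (intro lexp_cong) simp
  also have "\<dots> = lexp q {1..n} (\<lambda>xs. ?F (take m xs)) * lexp q {..<card {1..n} - m} ?G"
    using assms by (intro lexp_take_drop[OF q _ _ oi]) auto
  also have "lexp q {..<card {1..n} - m} ?G = lexp q {1..n} (\<lambda>xs. ?G (drop m xs))"
    using assms by (intro lexp_drop[OF q _ _ oi, symmetric]) auto
  also have "\<dots> = E G"
    unfolding E_lexp using G by (intro lexp_cong) simp
  also have "lexp q {1..n} (\<lambda>xs. ?F (take m xs)) = E F"
    unfolding E_lexp using F by (intro lexp_cong) simp
  finally show ?thesis .
qed

text \<open>
  Only positions in \<open>{s..t}\<close> are searched for an intermediate value; for \<open>{1..n}\<close> this is the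
  indicator of \<open>v (i + 1) = v i + 1\<close>.
\<close>

definition gapless :: "nat \<Rightarrow> nat \<Rightarrow> nat \<Rightarrow> (nat \<Rightarrow> nat) \<Rightarrow> real"
  where "gapless s t i v =
    of_bool (v i < v (i + 1) \<and> (\<forall>j\<in>{s..t}. \<not> (v i < v j \<and> v j < v (i + 1))))"

lemma depends_on_gapless:
  assumes "{s..t} \<union> {i, i + 1} \<subseteq> W"
  shows "depends_on W (gapless s t i)"
  unfolding depends_on_def
proof (intro allI impI)
  fix u v :: "nat \<Rightarrow> nat"
  assume *: "\<forall>j\<in>W. \<forall>k\<in>W. u j < u k \<longleftrightarrow> v j < v k"
  have "i \<in> W" "i + 1 \<in> W" "\<And>j. j \<in> {s..t} \<Longrightarrow> j \<in> W"
    using assms by auto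
  then have "u i < u (i + 1) \<longleftrightarrow> v i < v (i + 1)"
    "\<And>j. j \<in> {s..t} \<Longrightarrow> u i < u j \<longleftrightarrow> v i < v j"
    "\<And>j. j \<in> {s..t} \<Longrightarrow> u j < u (i + 1) \<longleftrightarrow> v j < v (i + 1)"
    using * by blast+
  then show "gapless s t i u = gapless s t i v"
    unfolding gapless_def by simp
qed

text \<open>The probability that a weighted random word of \<open>M + 1\<close> letters starts with
  two letters of consecutive increasing ranks; \<open>x\<close> is the rank of the first
  one.\<close>

definition beta :: "nat \<Rightarrow> real"
  where "beta M = (\<Sum>x<M. q ^ (2 * x)) / (qint q (M + 1) * qint q M)"

text \<open>If a word starts with \<open>x, x + 1\<close>, each of these two letters exceeds exactly
  \<open>x\<close> of the letters after it, hence the weight \<open>q ^ (2 * x)\<close>; the other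
  \<open>k\<close> letters are free.\<close>

lemma wsum_gapless:
  "wsum q {..<Suc (Suc k)} (\<lambda>xs. of_bool (xs ! 1 = Suc (xs ! 0))) = (\<Sum>x<Suc k. q ^ (2 * x)) * qfact q k"
proof -
  let ?S = "{..<Suc (Suc k)}"
  have inner: "wsum q (?S - {x}) (\<lambda>ys. of_bool (ys ! 0 = Suc x)) =
      (if x < Suc k then q ^ x * qfact q k else 0)" if "x \<in> ?S" for x
  proof -
    have "card (?S - {x}) = Suc k" using that by simp
    then have ne: "?S - {x} \<noteq> {}" by (metis card.empty nat.distinct(1))
    have "wsum q (?S - {x}) (\<lambda>ys. of_bool (ys ! 0 = Suc x)) =
        (\<Sum>y\<in>?S - {x}. q ^ card {z \<in> ?S - {x}. z < y} * (of_bool (y = Suc x) * qfact q k))"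
    proof (subst wsum_Cons[OF _ ne], simp, intro sum.cong refl)
      fix y assume y: "y \<in> ?S - {x}"
      then have "wsum q (?S - {x} - {y}) (\<lambda>_. 1) = qfact q k"
        using that by (subst wsum_one) auto
      then show "q ^ card {z \<in> ?S - {x}. z < y} *
          wsum q (?S - {x} - {y}) (\<lambda>ys. of_bool ((y # ys) ! 0 = Suc x)) =
          q ^ card {z \<in> ?S - {x}. z < y} * (of_bool (y = Suc x) * qfact q k)"
        using wsum_const_mult[of q "?S - {x} - {y}" "of_bool (y = Suc x)" "\<lambda>_. 1"] by simp
    qed
    also have "\<dots> = (if x < Suc k then q ^ card {z \<in> ?S - {x}. z < Suc x} * qfact q k else 0)"
    proof -
      have "(\<Sum>y\<in>?S - {x}. q ^ card {z \<in> ?S - {x}. z < y} * (of_bool (y = Suc x) * qfact q k)) =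
          (\<Sum>y\<in>?S - {x}. if y = Suc x then q ^ card {z \<in> ?S - {x}. z < Suc x} * qfact q k else 0)"
        by (intro sum.cong refl) simp
      then show ?thesis
        by (simp only: sum.delta finite_Diff finite_lessThan) simp
    qed
    also have "{z \<in> ?S - {x}. z < Suc x} = {..<x}"
      using that by auto
    finally show ?thesis by simp
  qed
  have "wsum q ?S (\<lambda>xs. of_bool (xs ! 1 = Suc (xs ! 0))) =
      (\<Sum>x\<in>?S. q ^ card {y \<in> ?S. y < x} * wsum q (?S - {x}) (\<lambda>ys. of_bool (ys ! 0 = Suc x)))"
    by (subst wsum_Cons) auto
  also have "\<dots> = (\<Sum>x\<in>?S. q ^ x * (if x < Suc k then q ^ x * qfact q k else 0))"
  proof (intro sum.cong refl)
    fix x assume x: "x \<in> ?S"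
    then have "{y \<in> ?S. y < x} = {..<x}" by auto
    then show "q ^ card {y \<in> ?S. y < x} * wsum q (?S - {x}) (\<lambda>ys. of_bool (ys ! 0 = Suc x)) =
        q ^ x * (if x < Suc k then q ^ x * qfact q k else 0)"
      using inner[OF x] by simp
  qed
  also have "\<dots> = (\<Sum>x<Suc k. q ^ x * (q ^ x * qfact q k))"
    by (simp add: lessThan_Suc)
  also have "\<dots> = (\<Sum>x<Suc k. q ^ (2 * x)) * qfact q k"
    unfolding sum_distrib_right by (intro sum.cong refl) (simp add: power_add mult_2)
  finally show ?thesis .
qed

lemma E_gapless_right:
  assumes "1 \<le> i" "i < t" "t \<le> n"
  shows "E (gapless i t i) = beta (t - i)"
proof -
  obtain k where k: "t = i + Suc k"
    using less_imp_Suc_add[OF assms(2)] by auto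
  \<comment> \<open>The window carries a word on an initial segment of the naturals, where the
    absence of an intermediate letter means that the two values are consecutive integers.\<close>
  have eq: "gapless i t i (\<lambda>j. zs ! (j - i)) = of_bool (zs ! 1 = Suc (zs ! 0))"
    if "distinct zs" "set zs = {..<Suc (Suc k)}" for zs
  proof -
    have len: "length zs = Suc (Suc k)"
      using distinct_card[OF that(1)] that(2) by simp
    have "zs ! 0 \<noteq> zs ! 1"
      using that(1) len by (simp add: nth_eq_iff_index_eq)
    have "(\<forall>j\<in>{i..t}. \<not> (zs ! 0 < zs ! (j - i) \<and> zs ! (j - i) < zs ! 1)) \<longleftrightarrow>
        (\<forall>z\<in>set zs. \<not> (zs ! 0 < z \<and> z < zs ! 1))" (is "?L \<longleftrightarrow> ?R")
    proof
      assume L: ?L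
      show ?R
      proof
        fix z assume "z \<in> set zs"
        then obtain l where "z = zs ! l" "l < length zs"
          by (auto simp: in_set_conv_nth)
        then show "\<not> (zs ! 0 < z \<and> z < zs ! 1)"
          using L[rule_format, of "i + l"] len k by simp
      qed
    qed (use len k in auto)
    moreover have "zs ! 1 \<in> set zs"
      using len by (intro nth_mem) auto
    then have "zs ! 1 < Suc (Suc k)" using that by auto
    then have "(zs ! 0 < zs ! 1 \<and> ?R) \<longleftrightarrow> zs ! 1 = Suc (zs ! 0)"
      unfolding that(2) using Suc_lessI by (auto; fastforce)
    ultimately show ?thesis
      by (simp add: gapless_def)
  qed
  have "E (gapless i t i) = lexp q {..<t + 1 - i} (\<lambda>zs. gapless i t i (\<lambda>j. zs ! (j - i)))"
    using assms by (intro E_window depends_on_gapless) auto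
  also have "\<dots> = wsum q {..<Suc (Suc k)} (\<lambda>zs. gapless i t i (\<lambda>j. zs ! (j - i))) / qfact q (Suc (Suc k))"
    using k by (simp add: lexp_def)
  also have "wsum q {..<Suc (Suc k)} (\<lambda>zs. gapless i t i (\<lambda>j. zs ! (j - i))) =
      wsum q {..<Suc (Suc k)} (\<lambda>xs. of_bool (xs ! 1 = Suc (xs ! 0)))"
    by (rule wsum_cong) (rule eq)
  finally show ?thesis
    using qfact_pos[OF q, of k] k unfolding wsum_gapless by (simp add: qfact_Suc beta_def)
qed

end

section \<open>Variance of the number of adjacencies\<close>

lemma qint_add: "qint q (a + b) = qint q a + q ^ a * qint q b"
  by (induction b) (simp_all add: qint_def power_add algebra_simps)

lemma qint_Suc: "qint q (Suc k) = qint q k + q ^ k"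
  by (simp add: qint_def)

text \<open>The multiplied-out form covers \<open>q = 1\<close> as well.\<close>

lemma qint_geometric: "(1 - q) * qint q k = 1 - q ^ k"
proof (induction k)
  case (Suc k)
  have "(1 - q) * qint q (Suc k) = (1 - q) * qint q k + (1 - q) * q ^ k"
    by (simp add: qint_Suc distrib_left)
  then show ?case
    unfolding Suc.IH by (simp add: algebra_simps)
qed (simp add: qint_def)

lemma qint_mono: "0 < q \<Longrightarrow> a \<le> b \<Longrightarrow> qint q a \<le> qint q b"
  unfolding qint_def by (intro sum_mono2) auto

context mallows
begin

definition cov :: "((nat \<Rightarrow> nat) \<Rightarrow> real) \<Rightarrow> ((nat \<Rightarrow> nat) \<Rightarrow> real) \<Rightarrow> real"
  where "cov F G = E (\<lambda>v. F v * G v) - E F * E G"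

lemma cov_commute: "cov F G = cov G F"
  by (simp add: cov_def mult.commute)

lemma variance_eq: "E (\<lambda>v. (F v - E F)\<^sup>2) = E (\<lambda>v. (F v)\<^sup>2) - (E F)\<^sup>2"
proof -
  have "E (\<lambda>v. (F v - E F)\<^sup>2) = E (\<lambda>v. (F v)\<^sup>2 - (2 * E F) * F v + (E F)\<^sup>2)"
    by (intro E_cong) (simp add: power2_eq_square algebra_simps)
  then show ?thesis
    by (simp add: E_add E_diff E_cmult power2_eq_square)
qed

lemma variance_sum:
  "E (\<lambda>v. ((\<Sum>i\<in>I. X i v) - E (\<lambda>v. \<Sum>i\<in>I. X i v))\<^sup>2) = (\<Sum>i\<in>I. \<Sum>k\<in>I. cov (X i) (X k))"
  unfolding variance_eq
  by (simp add: power2_eq_square sum_product E_sum cov_def sum_subtractf)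

text \<open>Each row of the covariance matrix is summed by distance from the diagonal: two arms,
  each of total at most \<open>C\<close>. The diagonal is counted in both, which is harmless because
  \<open>B\<close> is nonnegative.\<close>

lemma variance_sum_le:
  assumes cov: "\<And>i k. i \<in> {1..m} \<Longrightarrow> k \<in> {1..m} \<Longrightarrow> i \<le> k \<Longrightarrow> cov (X i) (X k) \<le> B (k - i)"
    and B: "\<And>d. B d \<ge> 0" "\<And>N. (\<Sum>d<N. B d) \<le> C"
  shows "E (\<lambda>v. ((\<Sum>i=1..m. X i v) - E (\<lambda>v. \<Sum>i=1..m. X i v))\<^sup>2) \<le> 2 * C * real m"
proof -
  have "(\<Sum>k=1..m. cov (X i) (X k)) \<le> 2 * C" if i: "i \<in> {1..m}" for i
  proof -
    have "(\<Sum>k=1..m. cov (X i) (X k)) \<le> (\<Sum>k=1..m. of_bool (k \<le> i) * B (i - k) + of_bool (i \<le> k) * B (k - i))"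
    proof (rule sum_mono)
      fix k assume k: "k \<in> {1..m}"
      show "cov (X i) (X k) \<le> of_bool (k \<le> i) * B (i - k) + of_bool (i \<le> k) * B (k - i)"
        using cov[OF i k] cov[OF k i] B(1)[of 0] by (cases i k rule: linorder_cases) (auto simp: cov_commute)
    qed
    also have "\<dots> = (\<Sum>k\<in>{1..i}. B (i - k)) + (\<Sum>k\<in>{i..m}. B (k - i))"
    proof -
      have "(\<Sum>k=1..m. of_bool (k \<le> i) * B (i - k)) = (\<Sum>k\<in>{1..i}. B (i - k))"
        using i by (intro sum.mono_neutral_cong_right) auto
      moreover have "(\<Sum>k=1..m. of_bool (i \<le> k) * B (k - i)) = (\<Sum>k\<in>{i..m}. B (k - i))"
        using i by (intro sum.mono_neutral_cong_right) auto
      ultimately show ?thesis by (simp add: sum.distrib)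
    qed
    also have "(\<Sum>k\<in>{1..i}. B (i - k)) = (\<Sum>d<i. B d)"
      by (rule sum.reindex_bij_witness[of _ "\<lambda>d. i - d" "\<lambda>k. i - k"]) auto
    also have "(\<Sum>k\<in>{i..m}. B (k - i)) = (\<Sum>d<Suc m - i. B d)"
      by (rule sum.reindex_bij_witness[of _ "\<lambda>d. d + i" "\<lambda>k. k - i"]) auto
    finally show ?thesis
      using B(2)[of i] B(2)[of "Suc m - i"] by simp
  qed
  then have "(\<Sum>i=1..m. \<Sum>k=1..m. cov (X i) (X k)) \<le> (\<Sum>i=1..m. 2 * C)"
    by (rule sum_mono)
  then show ?thesis
    unfolding variance_sum by (simp add: mult.commute)
qed

text \<open>The sum of even powers times \<open>1 + q\<close> is
  \<open>qint q (2 * M) = (1 + q ^ M) * qint q M\<close>, so one q-integer cancels.\<close>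

lemma beta_eq:
  assumes "M \<ge> 1"
  shows "beta M = (1 + q ^ M) / ((1 + q) * qint q (M + 1))"
proof -
  have "(1 + q) * (\<Sum>x<M. q ^ (2 * x)) = qint q (2 * M)"
    by (induction M) (simp_all add: qint_def algebra_simps)
  also have "\<dots> = (1 + q ^ M) * qint q M"
    unfolding mult_2 qint_add by (simp add: algebra_simps)
  finally have "(\<Sum>x<M. q ^ (2 * x)) = (1 + q ^ M) * qint q M / (1 + q)"
    using q by (simp add: field_simps)
  moreover have "qint q M > 0" "qint q (M + 1) > 0"
    using q assms by (auto intro!: qint_pos)
  ultimately show ?thesis
    using q by (simp add: beta_def)
qed

lemma gapless_antimono: "{s..t} \<subseteq> {s'..t'} \<Longrightarrow> gapless s' t' i v \<le> gapless s t i v"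
  unfolding gapless_def by (auto simp del: atLeastatMost_subset_iff)

lemma gapless_bounds: "0 \<le> gapless s t i v" "gapless s t i v \<le> 1"
  by (auto simp: gapless_def)

text \<open>Reversing positions and values sends the places \<open>k, k + 1\<close> to
  \<open>n - k + 1, n - k\<close> and keeps ascents, which reduces the claim to a window on the
  right.\<close>

lemma E_gapless_left:
  assumes "1 \<le> s" "s \<le> k" "k + 1 \<le> n"
  shows "E (gapless s (k + 1) k) = beta (k + 1 - s)"
proof -
  have "E (gapless s (k + 1) k) = E (\<lambda>v. gapless s (k + 1) k (flip n \<circ> v \<circ> flip n))"
    by (rule E_flip_flip[symmetric])
  also have "\<dots> = E (gapless (n - k) (n + 1 - s) (n - k))"
  proof (rule E_cong)
    fix v assume v: "v permutes {1..n}"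
    have fl: "flip n (v a) < flip n (v b) \<longleftrightarrow> v b < v a" if "a \<in> {1..n}" "b \<in> {1..n}" for a b
      using flip_less permutes_in_image[OF v] that by metis
    have k: "flip n k = n - k + 1" "flip n (k + 1) = n - k"
      using assms by (auto simp: flip_def)
    have j: "(\<forall>j\<in>{s..k + 1}. P (flip n j)) \<longleftrightarrow> (\<forall>j\<in>{n - k..n + 1 - s}. P j)" for P
    proof
      assume L: "\<forall>j\<in>{s..k + 1}. P (flip n j)"
      show "\<forall>j\<in>{n - k..n + 1 - s}. P j"
      proof
        fix j assume j: "j \<in> {n - k..n + 1 - s}"
        then have "flip n j \<in> {s..k + 1}"
          using assms by (auto simp: flip_def)
        then show "P j" using L by (metis flip_flip)
      qed
    next
      assume R: "\<forall>j\<in>{n - k..n + 1 - s}. P j"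
      show "\<forall>j\<in>{s..k + 1}. P (flip n j)"
      proof
        fix j assume "j \<in> {s..k + 1}"
        then have "flip n j \<in> {n - k..n + 1 - s}"
          using assms by (auto simp: flip_def)
        then show "P (flip n j)" using R by blast
      qed
    qed
    have mem: "n - k \<in> {1..n}" "n - k + 1 \<in> {1..n}"
      using assms by auto
    show "gapless s (k + 1) k (flip n \<circ> v \<circ> flip n) = gapless (n - k) (n + 1 - s) (n - k) v"
    proof -
      let ?Q = "\<lambda>j. \<not> (flip n (v (n - k + 1)) < flip n (v j) \<and> flip n (v j) < flip n (v (n - k)))"
      have "gapless s (k + 1) k (flip n \<circ> v \<circ> flip n) =
          of_bool (flip n (v (n - k + 1)) < flip n (v (n - k)) \<and> (\<forall>j\<in>{s..k + 1}. ?Q (flip n j)))"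
        by (simp only: gapless_def o_apply k)
      also have "\<dots> = of_bool (flip n (v (n - k + 1)) < flip n (v (n - k)) \<and> (\<forall>j\<in>{n - k..n + 1 - s}. ?Q j))"
        using j[of ?Q] by simp
      also have "\<dots> = gapless (n - k) (n + 1 - s) (n - k) v"
      proof -
        have "j \<in> {1..n}" if "j \<in> {n - k..n + 1 - s}" for j
          using that assms by auto
        then have "(\<forall>j\<in>{n - k..n + 1 - s}. ?Q j) \<longleftrightarrow>
            (\<forall>j\<in>{n - k..n + 1 - s}. \<not> (v (n - k) < v j \<and> v j < v (n - k + 1)))"
          using fl mem by (intro ball_cong refl) blast
        then show ?thesis
          unfolding gapless_def fl[OF mem(2,1)] by simp
      qed
      finally show ?thesis .
    qed
  qed
  also have "\<dots> = beta (n + 1 - s - (n - k))"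
    using assms by (intro E_gapless_right) auto
  also have "n + 1 - s - (n - k) = k + 1 - s"
    using assms by auto
  finally show ?thesis .
qed

end

section \<open>Covariances of adjacencies for \<open>q <= 1\<close>\<close>

locale mallows_le_1 = mallows +
  assumes q_le: "q \<le> 1"
begin

lemma beta_le: "M \<ge> 1 \<Longrightarrow> beta M \<le> 1 / qint q (M + 1)"
  using q q_le qint_pos[of q "M + 1"]
  by (subst beta_eq) (auto simp: divide_simps power_le_one intro: order_trans[OF power_decreasing[of 1]])

text \<open>No value of \<open>beta\<close> at an argument \<open>>= 1\<close> lies below
  \<open>(1 - q) / (1 + q)\<close>, and \<open>beta M\<close> exceeds this number by exactly the
  right-hand side.\<close>

lemma beta_diff_le:
  assumes "1 \<le> M" "1 \<le> M'"
  shows "beta M - beta M' \<le> q ^ M / qint q (M + 1)"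
proof -
  have pos: "qint q (M + 1) > 0" "qint q (M' + 1) > 0"
    using q by (auto intro!: qint_pos)
  have "(1 - q) / (1 + q) \<le> beta M'"
  proof -
    have "(1 - q) * qint q (M' + 1) \<le> 1 + q ^ M'"
      unfolding qint_geometric using q zero_le_power[of q M'] zero_le_power[of q "M' + 1"] by linarith
    then have "1 - q \<le> (1 + q ^ M') / qint q (M' + 1)"
      using pos by (simp add: pos_le_divide_eq)
    then have "(1 - q) / (1 + q) \<le> (1 + q ^ M') / qint q (M' + 1) / (1 + q)"
      using q by (intro divide_right_mono) auto
    then show ?thesis
      unfolding beta_eq[OF assms(2)] by (simp add: mult.commute)
  qed
  moreover have "beta M = (1 - q) / (1 + q) + q ^ M / qint q (M + 1)"
  proof -
    have "1 + q ^ M = (1 - q) * qint q (M + 1) + (1 + q) * q ^ M"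
      unfolding qint_geometric by (simp add: algebra_simps)
    then show ?thesis
      unfolding beta_eq[OF assms(1)] using pos q by (simp add: field_simps)
  qed
  ultimately show ?thesis by linarith
qed

lemma qint_ge_1: "qint q (Suc k) \<ge> 1"
  using qint_mono[of q 1 "Suc k"] q by (simp add: qint_def)

definition "adj = gapless 1 n"

text \<open>With \<open>r = d div 2\<close> the second case is
  \<open>2 * q ^ r / (qint q r * qint q (r + 1))\<close>, written as a difference so that the sum
  over \<open>d\<close> telescopes.\<close>

definition adj_cov_bound :: "nat \<Rightarrow> real"
  where "adj_cov_bound d = (if d \<le> 1 then 1 else 2 * (1 / qint q (d div 2) - 1 / qint q (d div 2 + 1)))"

text \<open>Testing only positions up to \<open>m\<close> for \<open>i\<close> and only positions
  after \<open>m\<close> for \<open>k\<close> enlarges both events and makes them independent. The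
  covariance is then at most \<open>(x' - x) * y' + x * (y' - y)\<close>, where the increments are
  small by \<open>beta_diff_le\<close> and the other factors by \<open>beta_le\<close>.\<close>

lemma cov_adj:
  assumes "1 \<le> i" "i \<le> k" "k \<le> n - 1"
  shows "cov (adj i) (adj k) \<le> adj_cov_bound (k - i)"
proof (cases "k - i \<le> 1")
  case True
  have "E (\<lambda>v. adj i v * adj k v) \<le> E (\<lambda>_. 1)"
    by (intro E_mono mult_le_one) (auto simp: adj_def gapless_bounds)
  moreover have "0 \<le> E (adj i)" "0 \<le> E (adj k)"
    using E_mono[of "\<lambda>_. 0"] by (auto simp: adj_def gapless_bounds)
  then have "0 \<le> E (adj i) * E (adj k)" by simp
  ultimately show ?thesis
    using True by (simp add: cov_def adj_cov_bound_def)
next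
  case False
  \<comment> \<open>Cutting halfway leaves at least \<open>r + 1\<close> positions in each of the
    windows \<open>{i..m}\<close> and \<open>{m + 1..k + 1}\<close>.\<close>
  define r m where "r = (k - i) div 2" and "m = i + r"
  have r: "1 \<le> r" "i < m" "m < n" "m + r \<le> k" "k + 1 \<le> n" "1 \<le> k"
    using False assms by (auto simp: r_def m_def)
  have km: "r \<le> k - m"
    using r by arith
  let ?x' = "E (gapless 1 m i)" and ?y' = "E (gapless (m + 1) n k)"
  let ?x = "E (adj i)" and ?y = "E (adj k)"
  let ?g = "q ^ r / qint q (r + 1)" and ?h = "1 / qint q (r + 1)"
  have Q: "qint q (r + 1) > 0" "qint q r > 0"
    using q r by (auto intro!: qint_pos)
  have tail: "q ^ M / qint q (M + 1) \<le> ?g" "1 / qint q (M + 1) \<le> ?h" if "r \<le> M" for M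
    using that q q_le Q qint_mono[of q "r + 1" "M + 1"]
    by (auto intro!: frac_le power_decreasing)
  have "E (\<lambda>v. adj i v * adj k v) \<le> E (\<lambda>v. gapless 1 m i v * gapless (m + 1) n k v)"
    unfolding adj_def using r by (intro E_mono mult_mono gapless_antimono gapless_bounds) auto
  also have "\<dots> = ?x' * ?y'"
    using r assms by (intro E_indep[of m "gapless 1 m i" "gapless (m + 1) n k"] depends_on_gapless) auto
  finally have 1: "cov (adj i) (adj k) \<le> ?x' * ?y' - ?x * ?y"
    by (simp add: cov_def)
  have xdiff: "?x' - ?x \<le> ?g"
  proof -
    \<comment> \<open>The difference indicates that intermediate values exist but all lie beyond
      \<open>m\<close>. Ignoring the positions before \<open>i\<close> can only make this more
      likely, and the one-sided windows have explicit probabilities.\<close>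
    have "?x' - ?x \<le> E (\<lambda>v. gapless i m i v - gapless i n i v)"
      unfolding E_diff[symmetric] adj_def
    proof (rule E_mono)
      fix v
      show "gapless 1 m i v - gapless 1 n i v \<le> gapless i m i v - gapless i n i v"
        unfolding gapless_def using r assms by (auto simp: not_le)
    qed
    also have "\<dots> = beta (m - i) - beta (n - i)"
      using r assms by (simp add: E_diff E_gapless_right)
    also have "\<dots> \<le> ?g"
      using beta_diff_le[of "m - i" "n - i"] tail(1)[of "m - i"] r m_def by simp
    finally show ?thesis .
  qed
  have ydiff: "?y' - ?y \<le> ?g"
  proof -
    have "?y' - ?y \<le> E (\<lambda>v. gapless (m + 1) (k + 1) k v - gapless 1 (k + 1) k v)"
      unfolding E_diff[symmetric] adj_def
    proof (rule E_mono)
      fix v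
      show "gapless (m + 1) n k v - gapless 1 n k v \<le> gapless (m + 1) (k + 1) k v - gapless 1 (k + 1) k v"
        unfolding gapless_def using r assms by (auto simp: not_le)
    qed
    also have "\<dots> = beta (k - m) - beta k"
      using r E_gapless_left[of "m + 1" k] E_gapless_left[of 1 k] by (simp add: E_diff)
    also have "\<dots> \<le> q ^ (k - m) / qint q (k - m + 1)"
      using km r by (intro beta_diff_le) auto
    also have "\<dots> \<le> ?g"
      by (rule tail(1)[OF km])
    finally show ?thesis .
  qed
  have "?x \<le> E (gapless i m i)"
    unfolding adj_def using r assms by (intro E_mono gapless_antimono) auto
  also have "\<dots> \<le> ?h"
    using E_gapless_right[of i m] beta_le[of "m - i"] tail(2)[of "m - i"] r m_def assms by simp
  finally have x: "?x \<le> ?h" .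
  have "?y' \<le> E (gapless (m + 1) (k + 1) k)"
    using r assms by (intro E_mono gapless_antimono) auto
  also have "\<dots> \<le> ?h"
    using E_gapless_left[of "m + 1" k] beta_le[of "k - m"] tail(2)[OF km] km r by simp
  finally have y': "?y' \<le> ?h" .
  have nonneg: "0 \<le> ?x" "0 \<le> ?y'" "0 \<le> ?g"
    using E_mono[of "\<lambda>_. 0"] q Q by (auto simp: adj_def gapless_bounds)
  have "?x' * ?y' - ?x * ?y = (?x' - ?x) * ?y' + ?x * (?y' - ?y)"
    by (simp add: algebra_simps)
  also have "\<dots> \<le> ?g * ?h + ?h * ?g"
  proof (intro add_mono)
    show "(?x' - ?x) * ?y' \<le> ?g * ?h"
      using mult_right_mono[OF xdiff nonneg(2)] mult_left_mono[OF y' nonneg(3)] by linarith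
    show "?x * (?y' - ?y) \<le> ?h * ?g"
      using mult_left_mono[OF ydiff nonneg(1)] mult_right_mono[OF x nonneg(3)] by linarith
  qed
  also have "\<dots> = 2 * (q ^ r / (qint q (r + 1) * qint q (r + 1)))"
    by simp
  \<comment> \<open>Weakening one factor to \<open>qint q r\<close> produces the telescoping form,
    since \<open>q ^ r\<close> is the difference of the two q-integers.\<close>
  also have "q ^ r / (qint q (r + 1) * qint q (r + 1)) \<le> q ^ r / (qint q r * qint q (r + 1))"
    using q Q qint_mono[of q r "r + 1"] by (intro divide_left_mono mult_right_mono) auto
  also have "q ^ r / (qint q r * qint q (r + 1)) = 1 / qint q r - 1 / qint q (r + 1)"
    using Q by (simp add: qint_Suc field_simps)
  finally show ?thesis
    using 1 False by (simp add: adj_cov_bound_def r_def)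
qed

lemma adj_cov_bound_nonneg: "adj_cov_bound d \<ge> 0"
proof (cases "d \<le> 1")
  case False
  then have "0 < qint q (d div 2)" "qint q (d div 2) \<le> qint q (d div 2 + 1)"
    using q by (auto intro!: qint_pos qint_mono)
  with False show ?thesis
    by (simp add: adj_cov_bound_def frac_le)
qed (simp add: adj_cov_bound_def)

text \<open>The distances 0 and 1 contribute 2. The distances \<open>2 * r\<close> and
  \<open>2 * r + 1\<close> share one bound, so the remainder telescopes to at most 4, whatever
  \<open>q\<close> is.\<close>

lemma sum_adj_cov_bound: "(\<Sum>d<N. adj_cov_bound d) \<le> 6"
proof -
  have even: "(\<Sum>d<2 * Suc k. adj_cov_bound d) = 2 + 4 * (1 - 1 / qint q (Suc k))" for k
  proof (induction k)
    case 0
    then show ?case by (simp add: adj_cov_bound_def qint_def numeral_2_eq_2)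
  next
    case (Suc k)
    have "(\<Sum>d<2 * Suc (Suc k). adj_cov_bound d) =
        (\<Sum>d<2 * Suc k. adj_cov_bound d) + adj_cov_bound (2 * Suc k) + adj_cov_bound (Suc (2 * Suc k))"
      by simp
    also have "adj_cov_bound (2 * Suc k) = 2 * (1 / qint q (Suc k) - 1 / qint q (Suc (Suc k)))"
      by (simp add: adj_cov_bound_def)
    also have "adj_cov_bound (Suc (2 * Suc k)) = 2 * (1 / qint q (Suc k) - 1 / qint q (Suc (Suc k)))"
      by (simp add: adj_cov_bound_def)
    finally show ?case unfolding Suc.IH by simp
  qed
  have "(\<Sum>d<N. adj_cov_bound d) \<le> (\<Sum>d<2 * Suc N. adj_cov_bound d)"
    by (intro sum_mono2) (auto simp: adj_cov_bound_nonneg)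
  also have "\<dots> \<le> 6"
    unfolding even using qint_ge_1[of N] by simp
  finally show ?thesis .
qed

lemma variance_adj:
  "E (\<lambda>v. ((\<Sum>i=1..n - 1. adj i v) - E (\<lambda>v. \<Sum>i=1..n - 1. adj i v))\<^sup>2) \<le> 12 * real (n - 1)"
  using variance_sum_le[of "n - 1" adj adj_cov_bound 6] cov_adj adj_cov_bound_nonneg sum_adj_cov_bound
  by auto

end

section \<open>The effect of a transposition on descents\<close>

context mallows
begin

definition pat132 :: "nat \<Rightarrow> (nat \<Rightarrow> nat) \<Rightarrow> bool"
  where "pat132 i v \<longleftrightarrow> v i < v (i + 2) \<and> v (i + 2) < v (i + 1)"

definition pat213 :: "nat \<Rightarrow> (nat \<Rightarrow> nat) \<Rightarrow> bool"
  where "pat213 i v \<longleftrightarrow> v (i + 1) < v i \<and> v i < v (i + 2)"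

text \<open>Write \<open>A\<close> for the probability of the pattern 123. Adjacent swaps lead from
  123 to 132 and to 213, each of probability \<open>q * A\<close>, and from 213 to 231, of
  probability \<open>q\<^sup>2 * A\<close>. The ascents at \<open>i\<close> are the patterns 123,
  132 and 231, which determines \<open>A\<close>.\<close>

lemma E_patterns:
  assumes "1 \<le> i" "i + 2 \<le> n"
  shows "E (\<lambda>v. of_bool (pat132 i v)) = q / ((1 + q) * (1 + q + q\<^sup>2))"
    and "E (\<lambda>v. of_bool (pat213 i v)) = q / ((1 + q) * (1 + q + q\<^sup>2))"
proof -
  let ?A = "E (\<lambda>v. of_bool (v i < v (i + 1) \<and> v (i + 1) < v (i + 2)))"
  let ?B = "E (\<lambda>v. of_bool (pat132 i v))" and ?C = "E (\<lambda>v. of_bool (pat213 i v))"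
  let ?D = "E (\<lambda>v. of_bool (v (i + 2) < v i \<and> v i < v (i + 1)))"
  have i: "i \<in> {1..n - 1}" "i + 1 \<in> {1..n - 1}"
    using assms by auto
  have neq: "v a \<noteq> v b" if "v permutes {1..n}" "a \<noteq> b" for v a b
    using that by (metis permutes_inj injD)
  have t: "swap i v i = v (i + 1)" "swap i v (i + 1) = v i" "swap i v (i + 2) = v (i + 2)"
    "swap (i + 1) v i = v i" "swap (i + 1) v (i + 1) = v (i + 2)" "swap (i + 1) v (i + 2) = v (i + 1)" for v
    by (simp_all add: Transposition.transpose_def)
  have B: "?B = q * ?A"
  proof -
    have "?B = E (\<lambda>v. dsc (i + 1) v * of_bool (v i < v (i + 2)))"
      by (rule E_cong) (auto simp: dsc_def pat132_def)
    also have "\<dots> = q * E (\<lambda>v. asc (i + 1) v * of_bool (v i < v (i + 1)))"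
      by (subst E_swap[OF i(2)]) (simp only: t)
    also have "E (\<lambda>v. asc (i + 1) v * of_bool (v i < v (i + 1))) = ?A"
      by (rule E_cong) (auto simp: asc_def)
    finally show ?thesis .
  qed
  have C: "?C = q * ?A"
  proof -
    have "?C = E (\<lambda>v. dsc i v * of_bool (v i < v (i + 2)))"
      by (rule E_cong) (auto simp: dsc_def pat213_def)
    also have "\<dots> = q * E (\<lambda>v. asc i v * of_bool (v (i + 1) < v (i + 2)))"
      by (subst E_swap[OF i(1)]) (simp only: t)
    also have "E (\<lambda>v. asc i v * of_bool (v (i + 1) < v (i + 2))) = ?A"
      by (rule E_cong) (auto simp: asc_def)
    finally show ?thesis .
  qed
  have D: "?D = q * ?C"
  proof -
    have "?D = E (\<lambda>v. dsc (i + 1) v * of_bool (v (i + 2) < v i \<and> v i < v (i + 1)))"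
      by (rule E_cong) (auto simp: dsc_def)
    also have "\<dots> = q * E (\<lambda>v. asc (i + 1) v * of_bool (v (i + 1) < v i \<and> v i < v (i + 2)))"
      by (subst E_swap[OF i(2)]) (simp only: t)
    also have "E (\<lambda>v. asc (i + 1) v * of_bool (v (i + 1) < v i \<and> v i < v (i + 2))) = ?C"
      by (rule E_cong) (auto simp: asc_def pat213_def)
    finally show ?thesis .
  qed
  have "E (asc i) = ?A + ?B + ?D"
    unfolding E_add[symmetric]
  proof (rule E_cong)
    fix v assume v: "v permutes {1..n}"
    have "v i \<noteq> v (i + 2)" "v (i + 1) \<noteq> v (i + 2)"
      using neq[OF v] by auto
    then show "asc i v = of_bool (v i < v (i + 1) \<and> v (i + 1) < v (i + 2)) + of_bool (pat132 i v) +
        of_bool (v (i + 2) < v i \<and> v i < v (i + 1))"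
      by (auto simp: asc_def pat132_def)
  qed
  moreover have "E (asc i) = 1 / (1 + q)"
  proof -
    have "E (asc i) = E (\<lambda>v. 1 - dsc i v)"
      by (rule E_cong) (rule asc_dsc)
    then show ?thesis
      using q E_dsc[OF i(1)] by (simp add: E_diff p_def field_simps)
  qed
  ultimately have "?A * (1 + q + q\<^sup>2) = 1 / (1 + q)"
    unfolding D C B by (simp add: algebra_simps power2_eq_square)
  moreover have "1 + q + q\<^sup>2 > 0"
    using q by (simp add: add_pos_pos)
  moreover have "x = b / c" if "x * c = b" "c > 0" for x b c :: real
    using that by auto
  ultimately have "?A = 1 / (1 + q) / (1 + q + q\<^sup>2)"
    by blast
  then have "?A = 1 / ((1 + q) * (1 + q + q\<^sup>2))"
    by (simp only: divide_divide_eq_left)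
  then show "?B = q / ((1 + q) * (1 + q + q\<^sup>2))" "?C = q / ((1 + q) * (1 + q + q\<^sup>2))"
    unfolding B C by simp_all
qed

section \<open>Change of the descent statistics under an adjacent transposition\<close>

definition Y :: "(nat \<Rightarrow> nat) \<Rightarrow> real"
  where "Y v = real (des n v + des n (inv v))"

lemma des_sum: "real (des n v) = (\<Sum>j=1..n - 1. dsc j v)"
proof -
  have "(\<Sum>j=1..n - 1. dsc j v) = (\<Sum>j | j \<in> {1..n - 1} \<and> v j > v (j + 1). 1)"
    unfolding dsc_def of_bool_def by (rule sum.inter_filter[symmetric]) simp
  then show ?thesis by (simp add: des_def)
qed

text \<open>Swapping an ascent at \<open>i\<close> creates a descent there. It destroys one at
  \<open>i + 1\<close> exactly for the pattern 132 at \<open>i\<close>, and one at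
  \<open>i - 1\<close> exactly for 213 at \<open>i - 1\<close>; both patterns force the ascent. The
  side conditions discard neighbours outside \<open>{1..n}\<close>.\<close>

definition local_change :: "nat \<Rightarrow> (nat \<Rightarrow> nat) \<Rightarrow> real"
  where "local_change i v =
    asc i v - of_bool (i + 2 \<le> n \<and> pat132 i v) - of_bool (2 \<le> i \<and> pat213 (i - 1) v)"

lemma des_swap:
  assumes v: "v permutes {1..n}" and i: "i \<in> {1..n - 1}"
  shows "asc i v * (real (des n (swap i v)) - real (des n v)) = local_change i v"
proof -
  have neq: "v a \<noteq> v b" if "a \<noteq> b" for a b
    using that v by (metis permutes_inj injD)
  have *: "asc i v * (dsc j (swap i v) - dsc j v) =
      of_bool (j = i) * asc i v - of_bool (j = i + 1) * of_bool (pat132 i v)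
      - of_bool (j = i - 1) * of_bool (pat213 (i - 1) v)" if j: "j \<in> {1..n - 1}" for j
  proof -
    consider "j = i" | "j = i + 1" | "i = j + 1" | "j \<noteq> i" "j \<noteq> i + 1" "j + 1 \<noteq> i" by blast
    then show ?thesis
    proof cases
      case 1
      then show ?thesis using j by (auto simp: asc_def dsc_def Transposition.transpose_def)
    next
      case 2
      then show ?thesis
        using neq[of i "i + 2"] neq[of "i + 1" "i + 2"]
        by (auto simp: asc_def dsc_def Transposition.transpose_def pat132_def)
    next
      case 3
      then show ?thesis
        using neq[of i "i - 1"] neq[of "i + 1" "i - 1"] j
        by (auto simp: asc_def dsc_def Transposition.transpose_def pat213_def)
    next
      case 4
      then show ?thesis using j i
        by (auto simp: asc_def dsc_def Transposition.transpose_def)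
    qed
  qed
  have "asc i v * (real (des n (swap i v)) - real (des n v)) =
      (\<Sum>j=1..n - 1. of_bool (j = i) * asc i v - of_bool (j = i + 1) * of_bool (pat132 i v)
      - of_bool (j = i - 1) * of_bool (pat213 (i - 1) v))"
    unfolding des_sum sum_subtractf[symmetric] sum_distrib_left using * by (intro sum.cong) auto
  also have "\<dots> = (\<Sum>j=1..n - 1. if j = i then asc i v else 0)
      - (\<Sum>j=1..n - 1. if j = i + 1 then of_bool (pat132 i v) else 0)
      - (\<Sum>j=1..n - 1. if j = i - 1 then of_bool (pat213 (i - 1) v) else 0)"
    unfolding sum_subtractf[symmetric] by (intro sum.cong) auto
  also have "\<dots> = local_change i v"
    using i by (simp add: local_change_def) arith
  finally show ?thesis .
qed

text \<open>As \<open>v\<close> is onto, the value \<open>v i + 1\<close> is taken somewhere; if not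
  at \<open>i + 1\<close>, it is an intermediate value.\<close>

lemma gapless_all_iff:
  assumes v: "v permutes {1..n}" and i: "i \<in> {1..n - 1}"
  shows "gapless 1 n i v = of_bool (v (i + 1) = v i + 1)"
proof -
  have 1: "v (i + 1) = v i + 1"
    if less: "v i < v (i + 1)" and none: "\<forall>j\<in>{1..n}. \<not> (v i < v j \<and> v j < v (i + 1))"
  proof (rule ccontr)
    assume "v (i + 1) \<noteq> v i + 1"
    with less have lt: "v i + 1 < v (i + 1)" by simp
    moreover have "v (i + 1) \<in> {1..n}"
      using permutes_in_image[OF v, of "i + 1"] i by auto
    ultimately have "v i + 1 \<in> v ` {1..n}"
      unfolding permutes_image[OF v] by auto
    then obtain j where "j \<in> {1..n}" "v j = v i + 1" by auto
    with bspec[OF none \<open>j \<in> {1..n}\<close>] lt show False by simp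
  qed
  show ?thesis
  proof (cases "v (i + 1) = v i + 1")
    case True
    have "\<not> (v i < v j \<and> v j < v i + 1)" for j by linarith
    with True show ?thesis
      unfolding gapless_def by simp
  next
    case False
    then have "\<not> (v i < v (i + 1) \<and> (\<forall>j\<in>{1..n}. \<not> (v i < v j \<and> v j < v (i + 1))))"
      using 1 by blast
    with False show ?thesis
      unfolding gapless_def by (simp only: of_bool_eq)
  qed
qed

text \<open>On the inverse the swap acts by exchanging the values \<open>i\<close> and
  \<open>i + 1\<close>, which alters no comparison except between these two. A descent can thus
  change only where they are neighbours in the inverse; given an ascent of \<open>v\<close> at
  \<open>i\<close>, that means \<open>v (i + 1) = v i + 1\<close>, at place
  \<open>v i\<close>.\<close>

lemma des_inv_swap:
  assumes v: "v permutes {1..n}" and i: "i \<in> {1..n - 1}"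
  shows "asc i v * (real (des n (inv (swap i v))) - real (des n (inv v))) = gapless 1 n i v"
proof -
  let ?s = "Transposition.transpose i (i + 1)" and ?u = "inv v"
  have inv: "inv (swap i v) = ?s \<circ> ?u"
    using permutes_bij[OF v] by (simp add: o_inv_distrib)
  have u: "?u a = b \<longleftrightarrow> v b = a" for a b
    by (rule permutes_inv_eq[OF v])
  have *: "asc i v * (dsc j (?s \<circ> ?u) - dsc j ?u) =
      (if j = v i then of_bool (v (i + 1) = v i + 1) else 0)" for j
  proof -
    consider "?u j = i" "?u (j + 1) = i + 1" | "?u j = i + 1" "?u (j + 1) = i"
      | "{?u j, ?u (j + 1)} \<noteq> {i, i + 1}"
      unfolding doubleton_eq_iff by fast
    then show ?thesis
    proof cases
      case 1
      then have "v i = j" "v (i + 1) = j + 1"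
        using u by auto
      with 1 show ?thesis by (simp add: asc_def dsc_def)
    next
      case 2
      then have "v i = j + 1" "v (i + 1) = j"
        using u by auto
      then show ?thesis by (simp add: asc_def)
    next
      case 3
      have ne: "?u j \<noteq> ?u (j + 1)"
        using permutes_inj[OF permutes_inv[OF v]] by (metis injD n_not_Suc_n Suc_eq_plus1)
      have "dsc j (?s \<circ> ?u) = dsc j ?u"
      proof -
        have "?s b < ?s a \<longleftrightarrow> b < a" if "a \<noteq> b" "{a, b} \<noteq> {i, i + 1}" for a b
          using that by (auto simp: Transposition.transpose_def)
        from this[OF ne 3] show ?thesis by (simp add: dsc_def)
      qed
      moreover have "\<not> (j = v i \<and> v (i + 1) = v i + 1)"
      proof
        assume "j = v i \<and> v (i + 1) = v i + 1"
        then have "?u j = i" "?u (j + 1) = i + 1"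
          by (simp_all only: u)
        with 3 show False by simp
      qed
      ultimately show ?thesis by auto
    qed
  qed
  have "asc i v * (real (des n (inv (swap i v))) - real (des n (inv v))) =
      (\<Sum>j=1..n - 1. if j = v i then of_bool (v (i + 1) = v i + 1) else 0)"
    unfolding inv des_sum sum_subtractf[symmetric] sum_distrib_left using * by (intro sum.cong) auto
  also have "\<dots> = of_bool (v (i + 1) = v i + 1)"
  proof (cases "v (i + 1) = v i + 1")
    case True
    have "v i \<in> {1..n}" "v (i + 1) \<in> {1..n}"
      using permutes_in_image[OF v, of i] permutes_in_image[OF v, of "i + 1"] i by auto
    then have "v i \<in> {1..n - 1}"
      using True by auto
    with True show ?thesis by simp
  qed simp
  finally show ?thesis
    using gapless_all_iff[OF v i] by simp
qed

text \<open>The increment of \<open>Y\<close> at an ascent and zero at a descent, so the factor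
  \<open>asc i v\<close> is already built in.\<close>

definition change :: "nat \<Rightarrow> (nat \<Rightarrow> nat) \<Rightarrow> real"
  where "change i v = local_change i v + gapless 1 n i v"

lemma asc_cases: "asc i v = 0 \<or> asc i v = 1"
  by (simp add: asc_def)

lemma Y_swap:
  assumes v: "v permutes {1..n}" and i: "i \<in> {1..n - 1}"
  shows "asc i v * (Y (swap i v) - Y v) = change i v"
  using des_swap[OF assms] des_inv_swap[OF assms] by (simp add: Y_def change_def algebra_simps)

lemma asc_mult_Y_swap:
  assumes v: "v permutes {1..n}" and i: "i \<in> {1..n - 1}"
  shows "asc i v * (G (Y (swap i v)) - G (Y v)) = asc i v * (G (Y v + change i v) - G (Y v))"
proof (cases "asc i v = 0")
  case False
  then have "asc i v = 1" using asc_cases by blast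
  then have "Y (swap i v) = Y v + change i v"
    using Y_swap[OF assms] by simp
  then show ?thesis by simp
qed simp

lemma local_change_bound: "\<bar>local_change i v\<bar> \<le> 1"
  by (auto simp: local_change_def asc_def pat132_def pat213_def)

lemma change_bound: "\<bar>change i v\<bar> \<le> 2"
  using local_change_bound[of i v] gapless_bounds[of 1 n i v] unfolding change_def by linarith

lemma Y_inv: "v permutes {1..n} \<Longrightarrow> Y (inv v) = Y v"
  by (simp add: Y_def permutes_inv_inv)

definition U :: "(nat \<Rightarrow> nat) \<Rightarrow> real"
  where "U v = (\<Sum>i=1..n - 1. change i v)"

lemma E_Y: "E Y = 2 * p * real (n - 1)"
proof -
  have 1: "E (\<lambda>v. real (des n v)) = p * real (n - 1)"
    unfolding des_sum E_sum using E_dsc by simp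
  have "E Y = E (\<lambda>v. real (des n v)) + E (\<lambda>v. real (des n (inv v)))"
    unfolding E_add[symmetric] by (rule E_cong) (simp add: Y_def)
  also have "E (\<lambda>v. real (des n (inv v))) = E (\<lambda>v. real (des n v))"
    by (rule E_inv)
  finally show ?thesis using 1 by simp
qed

lemma E_Y_stein:
  "E (\<lambda>v. (Y v - E Y) * G (Y v)) =
    2 * p * (\<Sum>i=1..n - 1. E (\<lambda>v. asc i v * (G (Y v + change i v) - G (Y v))))"
proof -
  let ?d = "\<lambda>v. (real (des n v) - p * real (n - 1)) * G (Y v)"
  have "E (\<lambda>v. (Y v - E Y) * G (Y v)) = E ?d + E (\<lambda>v. ?d (inv v))"
    unfolding E_add[symmetric]
    by (rule E_cong) (use Y_inv E_Y in \<open>simp add: Y_def algebra_simps\<close>)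
  also have "E (\<lambda>v. ?d (inv v)) = E ?d"
    by (rule E_inv)
  also have "E ?d = (\<Sum>i=1..n - 1. E (\<lambda>v. (dsc i v - p) * G (Y v)))"
  proof -
    have "real (des n v) - p * real (n - 1) = (\<Sum>i=1..n - 1. dsc i v - p)" for v
      by (simp add: des_sum sum_subtractf)
    then show ?thesis
      unfolding E_sum[symmetric] by (simp add: sum_distrib_right)
  qed
  also have "\<dots> = (\<Sum>i=1..n - 1. p * E (\<lambda>v. asc i v * (G (Y v + change i v) - G (Y v))))"
  proof (rule sum.cong[OF refl])
    fix i assume i: "i \<in> {1..n - 1}"
    show "E (\<lambda>v. (dsc i v - p) * G (Y v)) = p * E (\<lambda>v. asc i v * (G (Y v + change i v) - G (Y v)))"
      unfolding E_dsc_centered[OF i, of "\<lambda>v. G (Y v)"]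
      by (rule arg_cong[where f = "(*) p"], rule E_cong, rule asc_mult_Y_swap[OF _ i])
  qed
  finally show ?thesis by (simp add: sum_distrib_left[symmetric])
qed

lemma asc_mult_change: "asc i v * change i v = change i v"
  by (auto simp: change_def local_change_def gapless_def asc_def pat132_def pat213_def)

text \<open>The exchange identity \<open>E_Y_stein\<close> with the identity function for
  \<open>G\<close>.\<close>

lemma variance_Y: "E (\<lambda>v. (Y v - E Y)\<^sup>2) = 2 * p * E U"
proof -
  have "E (\<lambda>v. (Y v - E Y)\<^sup>2) = E (\<lambda>v. (Y v - E Y) * Y v)"
  proof -
    have "E (\<lambda>v. (Y v - E Y) * Y v) = E (\<lambda>v. (Y v)\<^sup>2 - E Y * Y v)"
      by (rule E_cong) (simp add: power2_eq_square algebra_simps)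
    then show ?thesis
      unfolding variance_eq by (simp add: E_diff E_cmult power2_eq_square)
  qed
  also have "\<dots> = 2 * p * (\<Sum>i=1..n - 1. E (\<lambda>v. asc i v * change i v))"
    using E_Y_stein[of "\<lambda>x. x"] by simp
  also have "(\<Sum>i=1..n - 1. E (\<lambda>v. asc i v * change i v)) = E U"
    by (simp add: U_def[abs_def] E_sum asc_mult_change)
  finally show ?thesis .
qed

lemma depends_on_local_change:
  assumes "{i, i + 1} \<subseteq> W" "i + 2 \<le> n \<Longrightarrow> i + 2 \<in> W" "2 \<le> i \<Longrightarrow> i - 1 \<in> W"
  shows "depends_on W (local_change i)"
  unfolding depends_on_def
proof (intro allI impI)
  fix u v :: "nat \<Rightarrow> nat"
  assume *: "\<forall>j\<in>W. \<forall>k\<in>W. u j < u k \<longleftrightarrow> v j < v k"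
  have "asc i u = asc i v"
    using * assms(1) by (simp add: asc_def)
  moreover have "i + 2 \<le> n \<and> pat132 i u \<longleftrightarrow> i + 2 \<le> n \<and> pat132 i v"
    using * assms(1,2) unfolding pat132_def by blast
  moreover have "2 \<le> i \<and> pat213 (i - 1) u \<longleftrightarrow> 2 \<le> i \<and> pat213 (i - 1) v"
  proof (cases "2 \<le> i")
    case True
    then have "i - 1 + 1 = i" "i - 1 + 2 = i + 1" by auto
    then show ?thesis
      using * assms(1,3) True unfolding pat213_def by auto
  qed simp
  ultimately show "local_change i u = local_change i v"
    by (simp add: local_change_def)
qed

text \<open>Each summand sees only the positions \<open>i - 1, ..., i + 2\<close>, so indices at
  distance 4 or more are independent, with the cut after \<open>i + 2\<close>. Each of the four
  smaller distances costs at most 2, whence \<open>16 = 2 * 4 * 2\<close>.\<close>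

lemma variance_local_change:
  "E (\<lambda>v. ((\<Sum>i=1..n - 1. local_change i v) - E (\<lambda>v. \<Sum>i=1..n - 1. local_change i v))\<^sup>2)
    \<le> 16 * real (n - 1)"
proof -
  let ?B = "\<lambda>d::nat. if d < 4 then 2 else 0 :: real"
  have "cov (local_change i) (local_change k) \<le> ?B (k - i)"
    if "i \<in> {1..n - 1}" "k \<in> {1..n - 1}" "i \<le> k" for i k
  proof (cases "k - i < 4")
    case True
    have "\<bar>E (local_change i)\<bar> \<le> 1" for i
    proof -
      have "E (\<lambda>v. \<bar>local_change i v\<bar>) \<le> E (\<lambda>_. 1)"
        by (rule E_mono) (rule local_change_bound)
      then show ?thesis
        using E_abs[of "local_change i"] by simp
    qed
    then have "\<bar>E (local_change i) * E (local_change k)\<bar> \<le> 1 * 1"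
      unfolding abs_mult by (intro mult_mono) auto
    moreover have "E (\<lambda>v. local_change i v * local_change k v) \<le> E (\<lambda>_. 1)"
    proof (rule E_mono)
      fix v
      have "\<bar>local_change i v * local_change k v\<bar> \<le> 1 * 1"
        unfolding abs_mult using local_change_bound by (intro mult_mono) auto
      then show "local_change i v * local_change k v \<le> 1" by linarith
    qed
    ultimately show ?thesis
      using True by (simp add: cov_def)
  next
    case False
    have "E (\<lambda>v. local_change i v * local_change k v) = E (local_change i) * E (local_change k)"
      using that False by (intro E_indep[of "i + 2"] depends_on_local_change) auto
    then show ?thesis
      using False by (simp add: cov_def)
  qed
  moreover have "(\<Sum>d<N. ?B d) \<le> 8" for N
  proof -
    have "(\<Sum>d<N. ?B d) = (\<Sum>d | d \<in> {..<N} \<and> d < 4. 2)"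
      by (rule sum.inter_filter[symmetric]) simp
    also have "\<dots> \<le> (\<Sum>d<(4::nat). 2)"
      by (rule sum_mono2) auto
    finally show ?thesis by simp
  qed
  ultimately show ?thesis
    using variance_sum_le[of "n - 1" local_change ?B 8] by auto
qed

end

context mallows_le_1
begin

text \<open>The local and the adjacency parts are separated by
  \<open>(a + b)\<^sup>2 <= 2 * a\<^sup>2 + 2 * b\<^sup>2\<close>, so
  \<open>56 = 2 * 16 + 2 * 12\<close>.\<close>

lemma variance_U: "E (\<lambda>v. (U v - E U)\<^sup>2) \<le> 56 * real (n - 1)"
proof -
  let ?T = "\<lambda>v. \<Sum>i=1..n - 1. local_change i v" and ?K = "\<lambda>v. \<Sum>i=1..n - 1. adj i v"
  have U: "U v = ?T v + ?K v" for v
    by (simp add: U_def change_def adj_def sum.distrib)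
  have EU: "E U = E ?T + E ?K"
    unfolding E_add[symmetric] by (rule E_cong) (rule U)
  have "E (\<lambda>v. (U v - E U)\<^sup>2) \<le> E (\<lambda>v. 2 * (?T v - E ?T)\<^sup>2 + 2 * (?K v - E ?K)\<^sup>2)"
  proof (rule E_mono)
    fix v
    have "(a + b)\<^sup>2 \<le> 2 * a\<^sup>2 + 2 * b\<^sup>2" for a b :: real
      using zero_le_power2[of "a - b"] by (simp add: power2_eq_square algebra_simps)
    from this[of "?T v - E ?T" "?K v - E ?K"]
    show "(U v - E U)\<^sup>2 \<le> 2 * (?T v - E ?T)\<^sup>2 + 2 * (?K v - E ?K)\<^sup>2"
      unfolding U EU by (simp add: algebra_simps)
  qed
  also have "\<dots> = 2 * E (\<lambda>v. (?T v - E ?T)\<^sup>2) + 2 * E (\<lambda>v. (?K v - E ?K)\<^sup>2)"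
    by (simp only: E_add E_cmult)
  finally show ?thesis
    using variance_local_change variance_adj by linarith
qed

text \<open>The adjacency part is dropped as nonnegative. An ascent has probability
  \<open>1 / (1 + q)\<close>, and each of the two patterns removes at most \<open>?r\<close>; the
  resulting fraction equals \<open>1 / 6\<close> at \<open>q = 1\<close>.\<close>

lemma E_U_ge: "E U \<ge> real (n - 1) / 6"
proof -
  let ?r = "q / ((1 + q) * (1 + q + q\<^sup>2))"
  have r: "1 / 6 \<le> 1 / (1 + q) - 2 * ?r" "0 \<le> ?r"
  proof -
    have pos: "1 + q + q\<^sup>2 > 0" "1 + q > 0"
      using q by (simp_all add: add_pos_pos)
    then show "0 \<le> ?r" using q by simp
    have "1 / (1 + q) - 2 * ?r = (1 - q + q\<^sup>2) / ((1 + q) * (1 + q + q\<^sup>2))"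
      using pos by (simp add: divide_simps)
    moreover have "(1 + q) * (1 + q + q\<^sup>2) \<le> 6 * (1 - q + q\<^sup>2)"
    proof -
      have "(1 + q) * (1 + q + q\<^sup>2) \<le> 2 * (1 + q + q\<^sup>2)"
        using q_le pos by (intro mult_right_mono) auto
      moreover have "1 + q + q\<^sup>2 \<le> 3 * (1 - q + q\<^sup>2)"
        using zero_le_power2[of "1 - q"] by (simp add: power2_eq_square algebra_simps)
      then have "2 * (1 + q + q\<^sup>2) \<le> 6 * (1 - q + q\<^sup>2)"
        by (simp add: algebra_simps)
      ultimately show ?thesis by (rule order_trans)
    qed
    ultimately show "1 / 6 \<le> 1 / (1 + q) - 2 * ?r"
      using pos by (simp add: divide_simps)
  qed
  have "1 / 6 \<le> E (change i)" if i: "i \<in> {1..n - 1}" for i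
  proof -
    have "E (asc i) = E (\<lambda>v. 1 - dsc i v)"
      by (rule E_cong) (rule asc_dsc)
    then have asc: "E (asc i) = 1 / (1 + q)"
      using q E_dsc[OF i] by (simp add: E_diff p_def field_simps)
    have a: "E (\<lambda>v. of_bool (i + 2 \<le> n \<and> pat132 i v)) \<le> ?r"
      using E_patterns(1)[of i] i r(2) by (cases "i + 2 \<le> n") auto
    have b: "E (\<lambda>v. of_bool (2 \<le> i \<and> pat213 (i - 1) v)) \<le> ?r"
      using E_patterns(2)[of "i - 1"] i r(2) by (cases "2 \<le> i") auto
    have "E (change i) = E (asc i) - E (\<lambda>v. of_bool (i + 2 \<le> n \<and> pat132 i v))
        - E (\<lambda>v. of_bool (2 \<le> i \<and> pat213 (i - 1) v)) + E (gapless 1 n i)"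
      unfolding change_def[abs_def] local_change_def by (simp only: E_add E_diff)
    moreover have "0 \<le> E (gapless 1 n i)"
      using E_mono[of "\<lambda>_. 0" "gapless 1 n i"] gapless_bounds by simp
    ultimately show ?thesis
      using asc a b r(1) by linarith
  qed
  then have "(\<Sum>i=1..n - 1. 1 / 6) \<le> (\<Sum>i=1..n - 1. E (change i))"
    by (rule sum_mono)
  then show ?thesis
    unfolding U_def[abs_def] E_sum by simp
qed

end

section \<open>The Stein equation\<close>

text \<open>Every Gaussian tail inequality below is reduced by this to the sign of one
  derivative.\<close>

lemma tail_nonneg:
  fixes \<psi> \<psi>' :: "real \<Rightarrow> real"
  assumes deriv: "\<And>t. x \<le> t \<Longrightarrow> (\<psi> has_real_derivative \<psi>' t) (at t)"
    and nonpos: "\<And>t. x \<le> t \<Longrightarrow> \<psi>' t \<le> 0"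
    and lim: "(\<psi> \<longlongrightarrow> 0) at_top"
  shows "0 \<le> \<psi> x"
proof (rule tendsto_upperbound[OF lim])
  show "\<forall>\<^sub>F t in at_top. \<psi> t \<le> \<psi> x"
    using eventually_ge_at_top[of x]
  proof eventually_elim
    case (elim t)
    show ?case
    proof (rule DERIV_nonpos_imp_nonincreasing[OF elim])
      fix s assume "x \<le> s"
      then show "\<exists>y. (\<psi> has_real_derivative y) (at s) \<and> y \<le> 0"
        using deriv[of s] nonpos[of s] by auto
    qed
  qed
qed simp

text \<open>The antiderivative is the integral from minus infinity. Its limits come from dominated
  convergence, its derivative from the compact case.\<close>

lemma antiderivative_exists:
  fixes g :: "real \<Rightarrow> real"
  assumes cont: "continuous_on UNIV g" and int: "integrable lborel g"
  obtains F where "\<And>x. (F has_real_derivative g x) (at x)"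
    "(F \<longlongrightarrow> 0) at_bot" "(F \<longlongrightarrow> (\<integral>t. g t \<partial>lborel)) at_top"
proof
  define F where "F = (\<lambda>x. LINT t:{..x}|lborel. g t)"
  have si: "set_integrable lborel A g" if "A \<in> sets lborel" for A
    unfolding set_integrable_def using that int by (rule integrable_mult_indicator)
  have meas: "g \<in> borel_measurable borel"
    using cont by (rule borel_measurable_continuous_onI)
  show "(F has_real_derivative g x) (at x)" for x
  proof -
    \<comment> \<open>Near \<open>x\<close> only the integral over a compact interval varies, so the
      usual fundamental theorem applies.\<close>
    have F: "F y = F (x - 1) + integral {x - 1..y} g" if "y \<in> {x - 1..x + 1}" for y
    proof -
      have "{..y} = {..x - 1} \<union> {x - 1..y}" using that by auto
      then have "F y = F (x - 1) + (LINT t:{x - 1..y}|lborel. g t)"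
        unfolding F_def using AE_lborel_singleton[of "x - 1"]
        by (simp only:) (rule set_integral_Un_AE; auto simp: si elim: eventually_mono)
      then show ?thesis
        using set_borel_integral_eq_integral(2)[OF si, of "{x - 1..y}"] by simp
    qed
    have "((\<lambda>y. integral {x - 1..y} g) has_real_derivative g x) (at x within {x - 1..x + 1})"
      by (rule integral_has_real_derivative) (auto intro: continuous_on_subset[OF cont])
    then have "((\<lambda>y. F (x - 1) + integral {x - 1..y} g) has_real_derivative g x) (at x within {x - 1..x + 1})"
      by (auto intro!: derivative_eq_intros)
    then have "(F has_real_derivative g x) (at x within {x - 1..x + 1})"
      by (rule has_field_derivative_transform_within[where d = 1]) (auto simp: F[symmetric])
    then show ?thesis
      using at_within_interior[of x "{x - 1..x + 1}"] by simp
  qed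
  show "(F \<longlongrightarrow> (\<integral>t. g t \<partial>lborel)) at_top"
    unfolding F_def set_lebesgue_integral_def
    by (rule tendsto_integral_at_top) (auto simp: int)
  have "((\<lambda>y. F (- y)) \<longlongrightarrow> integral\<^sup>L lborel (\<lambda>t::real. 0 :: real)) at_top"
    unfolding F_def set_lebesgue_integral_def
  proof (rule integral_dominated_convergence_at_top[where w = "\<lambda>t. \<bar>g t\<bar>"
        and s = "\<lambda>y t. indicator {..- y} t *\<^sub>R g t" and f = "\<lambda>_. 0"])
    show "AE t in lborel. ((\<lambda>y. indicator {..- y} t *\<^sub>R g t) \<longlongrightarrow> 0) at_top"
    proof (rule AE_I2, rule tendsto_eventually)
      fix t
      show "\<forall>\<^sub>F y in at_top. indicator {..- y} t *\<^sub>R g t = 0"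
        using eventually_gt_at_top[of "- t"] by eventually_elim (auto simp: indicator_def)
    qed
    show "\<forall>\<^sub>F y in at_top. AE t in lborel. norm (indicator {..- y} t *\<^sub>R g t) \<le> \<bar>g t\<bar>"
      by (auto simp: indicator_def)
  qed (use meas int in auto)
  then show "(F \<longlongrightarrow> 0) at_bot"
    by (simp add: filterlim_at_bot_mirror)
qed

section \<open>Bounds for the Gaussian tail and the Stein solution\<close>

abbreviation \<phi> :: "real \<Rightarrow> real"
  where "\<phi> \<equiv> std_normal_density"

lemma phi_pos: "\<phi> x > 0"
  by (simp add: normal_density_pos)

lemma phi_minus: "\<phi> (- x) = \<phi> x"
  by (simp add: std_normal_density_def)

lemma has_real_derivative_phi: "(\<phi> has_real_derivative - x * \<phi> x) (at x)"
proof -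
  have "((\<lambda>x. 1 / sqrt (2 * pi) * exp (- x\<^sup>2 / 2)) has_real_derivative
      1 / sqrt (2 * pi) * (exp (- x\<^sup>2 / 2) * - x)) (at x)"
    by (rule DERIV_cmult) (auto intro!: derivative_eq_intros)
  then show ?thesis
    by (simp add: std_normal_density_def[abs_def] mult_ac)
qed

lemmas has_real_derivative_phi' [derivative_intros] = has_real_derivative_phi[THEN DERIV_chain2]

lemma continuous_on_phi: "continuous_on A \<phi>"
  unfolding std_normal_density_def by (intro continuous_intros) auto

lemma phi_at_top: "(\<phi> \<longlongrightarrow> 0) at_top"
  unfolding std_normal_density_def by real_asymp

text \<open>\<open>T\<close> is the upper tail probability of the standard normal law, characterised
  by its derivative and its limit.\<close>

locale gaussian_tail =
  fixes T :: "real \<Rightarrow> real"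
  assumes deriv_T: "\<And>x. (T has_real_derivative - \<phi> x) (at x)"
    and T_at_top: "(T \<longlongrightarrow> 0) at_top"
begin

lemma T_upper: "x * T x \<le> \<phi> x"
proof -
  have "0 \<le> \<phi> x - x * T x"
  proof (rule tail_nonneg[where x = x and \<psi> = "\<lambda>t. \<phi> t - x * T t"
        and \<psi>' = "\<lambda>t. - (t - x) * \<phi> t"])
    fix t assume "x \<le> t"
    show "((\<lambda>t. \<phi> t - x * T t) has_real_derivative - (t - x) * \<phi> t) (at t)"
      by (auto intro!: derivative_eq_intros deriv_T simp: algebra_simps)
    show "- (t - x) * \<phi> t \<le> 0"
      using \<open>x \<le> t\<close> phi_pos[of t] by (intro mult_nonpos_nonneg) auto
  qed (auto intro!: tendsto_eq_intros phi_at_top T_at_top)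
  then show ?thesis by simp
qed

text \<open>The classical lower bound for the Mills ratio; together with \<open>T_upper\<close> it
  shows that \<open>\<phi> x - x * T x\<close> lies between 0 and
  \<open>\<phi> x / (1 + x\<^sup>2)\<close> for \<open>x >= 0\<close>.\<close>

lemma T_lower: "x / (1 + x\<^sup>2) * \<phi> x \<le> T x"
proof -
  have "0 \<le> T x - x / (1 + x\<^sup>2) * \<phi> x"
  proof (rule tail_nonneg[where x = x and \<psi> = "\<lambda>t. T t - t / (1 + t\<^sup>2) * \<phi> t"
        and \<psi>' = "\<lambda>t. - (2 / (1 + t\<^sup>2)\<^sup>2) * \<phi> t"])
    fix t :: real
    have pos: "1 + t\<^sup>2 > 0"
      using zero_le_power2[of t] by linarith
    show "((\<lambda>t. T t - t / (1 + t\<^sup>2) * \<phi> t) has_real_derivative - (2 / (1 + t\<^sup>2)\<^sup>2) * \<phi> t) (at t)"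
      using pos
      by (auto intro!: derivative_eq_intros deriv_T)
        (simp add: divide_simps power2_eq_square, simp add: algebra_simps)
    show "- (2 / (1 + t\<^sup>2)\<^sup>2) * \<phi> t \<le> 0"
      using phi_pos[of t] by simp
  next
    have "((\<lambda>t. t / (1 + t\<^sup>2) * \<phi> t) \<longlongrightarrow> 0) at_top"
      unfolding std_normal_density_def by real_asymp
    then show "((\<lambda>t. T t - t / (1 + t\<^sup>2) * \<phi> t) \<longlongrightarrow> 0) at_top"
      using tendsto_diff[OF T_at_top] by fastforce
  qed
  then show ?thesis by simp
qed

lemma T_le_phi:
  assumes "0 \<le> x"
  shows "T x \<le> 3 / 2 * \<phi> x"
proof -
  \<comment> \<open>The coefficients 4 and 3 make the terms linear in \<open>t\<close> cancel in the
    numerator of the derivative, which leaves \<open>- (2 + 9 * t\<^sup>2)\<close>.\<close>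
  have "0 \<le> 6 / (4 + 3 * x) * \<phi> x - T x"
  proof (rule tail_nonneg[where x = x and \<psi> = "\<lambda>t. 6 / (4 + 3 * t) * \<phi> t - T t"
        and \<psi>' = "\<lambda>t. - ((2 + 9 * t\<^sup>2) / (4 + 3 * t)\<^sup>2) * \<phi> t"])
    fix t assume t: "x \<le> t"
    then have pos: "4 + 3 * t > 0" using assms by simp
    show "((\<lambda>t. 6 / (4 + 3 * t) * \<phi> t - T t) has_real_derivative
        - ((2 + 9 * t\<^sup>2) / (4 + 3 * t)\<^sup>2) * \<phi> t) (at t)"
      using pos
      by (auto intro!: derivative_eq_intros deriv_T)
        (simp add: divide_simps power2_eq_square, simp add: algebra_simps)
    show "- ((2 + 9 * t\<^sup>2) / (4 + 3 * t)\<^sup>2) * \<phi> t \<le> 0"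
      using phi_pos[of t] by simp
  next
    have "((\<lambda>t. 6 / (4 + 3 * t) * \<phi> t) \<longlongrightarrow> 0) at_top"
      unfolding std_normal_density_def by real_asymp
    then show "((\<lambda>t. 6 / (4 + 3 * t) * \<phi> t - T t) \<longlongrightarrow> 0) at_top"
      using tendsto_diff[OF _ T_at_top] by fastforce
  qed
  also have "6 / (4 + 3 * x) * \<phi> x \<le> 3 / 2 * \<phi> x"
    using assms phi_pos[of x] by (intro mult_right_mono) (auto simp: divide_simps)
  finally show ?thesis by simp
qed

text \<open>For \<open>f = F / \<phi>\<close> these are bounds on \<open>x * f x\<close>, on
  \<open>f x\<close> and on \<open>f' x = x * f x + h x - c\<close>. Vanishing at infinity makes
  \<open>F x\<close> minus the integral of \<open>(h - c) * \<phi>\<close> over the tail beyond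
  \<open>x\<close>.\<close>

lemma half_line_bounds:
  fixes h F :: "real \<Rightarrow> real"
  assumes deriv_F: "\<And>t. (F has_real_derivative (h t - c) * \<phi> t) (at t)"
    and F_at_top: "(F \<longlongrightarrow> 0) at_top"
    and bdd: "\<And>t. \<bar>h t - c\<bar> \<le> K"
    and lip: "\<And>s t. \<bar>h s - h t\<bar> \<le> L * \<bar>s - t\<bar>"
    and growth: "\<And>t. \<bar>h t - c\<bar> \<le> L * (\<bar>t\<bar> + 1)"
    and x: "0 \<le> x"
  shows "\<bar>x * F x\<bar> \<le> K * \<phi> x" "\<bar>F x\<bar> \<le> 5 / 2 * L * \<phi> x"
    "\<bar>(h x - c) * \<phi> x + x * F x\<bar> \<le> 2 * L * \<phi> x"
proof -
  have K: "0 \<le> K" using bdd[of 0] by linarith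
  have L: "0 \<le> L" using lip[of 0 1] by simp
  \<comment> \<open>A pointwise bound is integrated against \<open>\<phi>\<close> beyond
    \<open>x\<close>: constants integrate to \<open>T x\<close> and the identity to
    \<open>\<phi> x\<close>. The three uses below differ only in the parameters.\<close>
  have compare: "\<bar>a * F x + b * T x\<bar> \<le> d * T x + L * k * (\<phi> x + e * T x)"
    if bound: "\<And>t. x \<le> t \<Longrightarrow> \<bar>a * (h t - c) - b\<bar> \<le> d + L * k * (t + e)" for a b d k e
  proof -
    have "0 \<le> d * T x + L * k * (\<phi> x + e * T x) - s * (a * F x + b * T x)" if s: "s = 1 \<or> s = -1" for s
    proof (rule tail_nonneg[where x = x
          and \<psi> = "\<lambda>t. d * T t + L * k * (\<phi> t + e * T t) - s * (a * F t + b * T t)"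
          and \<psi>' = "\<lambda>t. - (d + L * k * (t + e) + s * (a * (h t - c) - b)) * \<phi> t"])
      fix t assume t: "x \<le> t"
      show "((\<lambda>t. d * T t + L * k * (\<phi> t + e * T t) - s * (a * F t + b * T t)) has_real_derivative
          - (d + L * k * (t + e) + s * (a * (h t - c) - b)) * \<phi> t) (at t)"
        by (auto intro!: derivative_eq_intros deriv_T deriv_F simp: algebra_simps)
      have "0 \<le> d + L * k * (t + e) + s * (a * (h t - c) - b)"
        using bound[OF t] s by (elim disjE; simp; linarith)
      then show "- (d + L * k * (t + e) + s * (a * (h t - c) - b)) * \<phi> t \<le> 0"
        using phi_pos[of t] by (intro mult_nonpos_nonneg) auto
    qed (auto intro!: tendsto_eq_intros T_at_top F_at_top phi_at_top)
    from this[of 1] this[of "- 1"] show ?thesis by (simp; linarith)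
  qed
  have Fx: "\<bar>F x\<bar> \<le> K * T x"
    using compare[of 1 0 K 0 0] bdd by simp
  have "\<bar>x * F x\<bar> = x * \<bar>F x\<bar>" using x by (simp add: abs_mult)
  also have "\<dots> \<le> x * (K * T x)"
    by (rule mult_left_mono[OF Fx x])
  also have "\<dots> = K * (x * T x)" by simp
  also have "\<dots> \<le> K * \<phi> x"
    by (rule mult_left_mono[OF T_upper K])
  finally show "\<bar>x * F x\<bar> \<le> K * \<phi> x" .
  have "\<bar>F x\<bar> \<le> L * (\<phi> x + T x)"
  proof -
    have "\<bar>1 * (h t - c) - 0\<bar> \<le> 0 + L * 1 * (t + 1)" if "x \<le> t" for t
      using growth[of t] that x by simp
    from compare[OF this] show ?thesis by simp
  qed
  also have "\<dots> \<le> L * (\<phi> x + 3 / 2 * \<phi> x)"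
    using T_le_phi[OF x] L by (intro mult_left_mono add_mono) auto
  finally show "\<bar>F x\<bar> \<le> 5 / 2 * L * \<phi> x" by simp
  \<comment> \<open>Freezing \<open>h\<close> at \<open>x\<close> turns \<open>F x\<close> into
    \<open>- ?m * T x\<close> up to an error \<open>L * ?r\<close>, where \<open>?r\<close> is the
    tail integral of \<open>(t - x) * \<phi> t\<close>.\<close>
  let ?m = "h x - c" and ?r = "\<phi> x - x * T x"
  have 1: "\<bar>F x + ?m * T x\<bar> \<le> L * ?r"
  proof -
    have "\<bar>1 * (h t - c) - ?m\<bar> \<le> 0 + L * 1 * (t + - x)" if "x \<le> t" for t
      using lip[of t x] that by simp
    from compare[OF this] show ?thesis by simp
  qed
  have r: "0 \<le> ?r" using T_upper[of x] by simp
  have "?m * \<phi> x + x * F x = ?m * ?r + x * (F x + ?m * T x)"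
    by (simp add: algebra_simps)
  also have "\<bar>\<dots>\<bar> \<le> \<bar>?m\<bar> * ?r + x * \<bar>F x + ?m * T x\<bar>"
    using x r by (intro order_trans[OF abs_triangle_ineq]) (simp add: abs_mult)
  also have "\<dots> \<le> L * (x + 1) * ?r + x * (L * ?r)"
    using growth[of x] x r 1 by (intro add_mono mult_right_mono mult_left_mono) auto
  also have "\<dots> = L * (2 * x + 1) * ?r"
    by (simp add: algebra_simps)
  also have "\<dots> \<le> L * (2 * x + 1) * (\<phi> x / (1 + x\<^sup>2))"
  proof (rule mult_left_mono)
    have "?r \<le> \<phi> x - x * (x / (1 + x\<^sup>2) * \<phi> x)"
      using mult_left_mono[OF T_lower[of x] x] by simp
    also have "\<dots> = \<phi> x / (1 + x\<^sup>2)"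
    proof -
      have "1 + x\<^sup>2 > 0"
        using zero_le_power2[of x] by linarith
      then show ?thesis by (simp add: field_simps power2_eq_square)
    qed
    finally show "?r \<le> \<phi> x / (1 + x\<^sup>2)" .
  qed (use L x in simp)
  also have "\<dots> = L * \<phi> x * ((2 * x + 1) / (1 + x\<^sup>2))"
    by simp
  also have "\<dots> \<le> L * \<phi> x * 2"
  proof (rule mult_left_mono)
    have "2 * x \<le> x\<^sup>2 + 1"
      using zero_le_power2[of "x - 1"] by (simp add: power2_diff)
    then have "2 * x + 1 \<le> 2 * (1 + x\<^sup>2)"
      using add_mono[OF _ zero_le_power2[of x], of "2 * x + 1" "x\<^sup>2 + 2"] by simp
    moreover have "1 + x\<^sup>2 > 0"
      using zero_le_power2[of x] by linarith
    ultimately show "(2 * x + 1) / (1 + x\<^sup>2) \<le> 2"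
      by (simp add: pos_divide_le_eq)
  qed (use L phi_pos[of x] in simp)
  finally show "\<bar>?m * \<phi> x + x * F x\<bar> \<le> 2 * L * \<phi> x"
    by (simp add: mult_ac)
qed

end

lemma gaussian_tail_exists: "\<exists>T. gaussian_tail T"
proof -
  obtain F where F: "\<And>x. (F has_real_derivative \<phi> x) (at x)" "(F \<longlongrightarrow> 1) at_top"
  proof (rule antiderivative_exists[of \<phi>])
    fix F
    assume "\<And>x. (F has_real_derivative \<phi> x) (at x)" "(F \<longlongrightarrow> (\<integral>t. \<phi> t \<partial>lborel)) at_top"
    then show thesis
      by (intro that[of F]) simp_all
  qed (auto simp: continuous_on_phi)
  have "gaussian_tail (\<lambda>x. 1 - F x)"
    by standard (auto intro!: derivative_eq_intros F(1) tendsto_eq_intros F(2))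
  then show ?thesis by blast
qed

text \<open>Centring by \<open>c\<close> makes the antiderivative of \<open>(h - c) * \<phi>\<close>
  vanish at both ends, so each half line is treated from its own end. The constant 4 is 2 for
  \<open>x * f x\<close> plus 2 for \<open>h x - c\<close>.\<close>

lemma stein_solution:
  fixes h :: "real \<Rightarrow> real"
  assumes bdd: "\<And>t. \<bar>h t\<bar> \<le> B"
    and lip: "\<And>s t. \<bar>h s - h t\<bar> \<le> L * \<bar>s - t\<bar>"
    and c: "c = (\<integral>t. \<phi> t * h t \<partial>lborel)"
  obtains f f' where "\<And>x. (f has_real_derivative f' x) (at x)"
    "\<And>x. f' x = x * f x + h x - c"
    "\<And>x. \<bar>f' x\<bar> \<le> 4 * B" "\<And>x. \<bar>f' x\<bar> \<le> 2 * L" "\<And>x. \<bar>f x\<bar> \<le> 5 / 2 * L"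
proof -
  have L: "0 \<le> L" using lip[of 0 1] by simp
  have cont: "continuous_on UNIV h"
  proof (rule lipschitz_on_continuous_on)
    show "L-lipschitz_on UNIV h"
      using lip L by (auto simp: lipschitz_on_def dist_real_def)
  qed
  have meas [measurable]: "h \<in> borel_measurable borel"
    using cont by (rule borel_measurable_continuous_onI)
  have int_abs: "integrable lborel (\<lambda>t. \<phi> t * \<bar>t\<bar>)"
    using integrable_std_normal_moment_abs[of 1] by simp
  have int_h: "integrable lborel (\<lambda>t. \<phi> t * h t)"
  proof (rule Bochner_Integration.integrable_bound)
    show "integrable lborel (\<lambda>t. \<phi> t * B)" by simp
    show "AE t in lborel. norm (\<phi> t * h t) \<le> norm (\<phi> t * B)"
    proof (rule AE_I2)
      fix t
      have "\<bar>h t\<bar> \<le> \<bar>B\<bar>" using bdd[of t] by linarith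
      then show "norm (\<phi> t * h t) \<le> norm (\<phi> t * B)"
        by (simp add: abs_mult mult_left_mono)
    qed
  qed simp
  have c_bdd: "\<bar>h t - c\<bar> \<le> 2 * B" for t
  proof -
    have "\<bar>c\<bar> \<le> (\<integral>t. \<bar>\<phi> t * h t\<bar> \<partial>lborel)"
      unfolding c by (rule integral_abs_bound)
    also have "\<dots> \<le> (\<integral>t. \<phi> t * B \<partial>lborel)"
      using int_h bdd phi_pos
      by (intro integral_mono integrable_abs integrable_mult_left) (auto simp: abs_mult intro!: mult_mono)
    finally show ?thesis using bdd[of t] by simp
  qed
  \<comment> \<open>Here \<open>c\<close> is the mean of \<open>h\<close> under the normal law, so
    the difference is at most \<open>L\<close> times the mean distance of \<open>t\<close> from a
    normal variable, whose absolute mean is \<open>sqrt (2 / pi) <= 1\<close>.\<close>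
  have growth: "\<bar>h t - c\<bar> \<le> L * (\<bar>t\<bar> + 1)" for t
  proof -
    have "h t - c = (\<integral>s. \<phi> s * h t - \<phi> s * h s \<partial>lborel)"
      unfolding c using int_h by (subst Bochner_Integration.integral_diff) auto
    also have "\<bar>\<dots>\<bar> \<le> (\<integral>s. \<bar>\<phi> s * h t - \<phi> s * h s\<bar> \<partial>lborel)"
      by (rule integral_abs_bound)
    also have "\<dots> \<le> (\<integral>s. L * (\<phi> s * \<bar>t\<bar> + \<phi> s * \<bar>s\<bar>) \<partial>lborel)"
    proof (rule integral_mono)
      fix s
      have "\<bar>\<phi> s * h t - \<phi> s * h s\<bar> = \<phi> s * \<bar>h t - h s\<bar>"
        using phi_pos[of s] by (simp add: abs_mult right_diff_distrib[symmetric])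
      also have "\<dots> \<le> \<phi> s * (L * (\<bar>t\<bar> + \<bar>s\<bar>))"
        using lip[of t s] phi_pos[of s] L
        by (intro mult_left_mono order_trans[OF lip] abs_triangle_ineq4) auto
      finally show "\<bar>\<phi> s * h t - \<phi> s * h s\<bar> \<le> L * (\<phi> s * \<bar>t\<bar> + \<phi> s * \<bar>s\<bar>)"
        by (simp add: algebra_simps)
    qed (use int_h int_abs in auto)
    also have "\<dots> = L * (\<bar>t\<bar> + sqrt (2 / pi))"
      using int_abs integral_std_normal_moment_abs_odd[of 0] by simp
    also have "\<dots> \<le> L * (\<bar>t\<bar> + 1)"
      using pi_ge_two L by (intro mult_left_mono add_left_mono) (auto simp: real_sqrt_le_1_iff)
    finally show ?thesis .
  qed
  have "(\<integral>t. (h t - c) * \<phi> t \<partial>lborel) = (\<integral>t. \<phi> t * h t - c * \<phi> t \<partial>lborel)"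
    by (simp add: algebra_simps)
  also have "\<dots> = 0"
    using int_h by (subst Bochner_Integration.integral_diff) (auto simp: c)
  finally have total: "(\<integral>t. (h t - c) * \<phi> t \<partial>lborel) = 0" .
  have int: "integrable lborel (\<lambda>t. (h t - c) * \<phi> t)"
  proof -
    have "integrable lborel (\<lambda>t. \<phi> t * h t - c * \<phi> t)"
      using int_h by (intro Bochner_Integration.integrable_diff) auto
    then show ?thesis by (simp add: algebra_simps)
  qed
  have "continuous_on UNIV (\<lambda>t. (h t - c) * \<phi> t)"
    by (intro continuous_intros cont continuous_on_phi)
  from antiderivative_exists[OF this int] total
  obtain F where F: "\<And>x. (F has_real_derivative (h x - c) * \<phi> x) (at x)"
    "(F \<longlongrightarrow> 0) at_bot" "(F \<longlongrightarrow> 0) at_top"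
    by metis
  obtain T where "gaussian_tail T"
    using gaussian_tail_exists by blast
  then interpret gaussian_tail T .
  have bounds: "\<bar>x * F x\<bar> \<le> 2 * B * \<phi> x \<and> \<bar>F x\<bar> \<le> 5 / 2 * L * \<phi> x \<and>
      \<bar>(h x - c) * \<phi> x + x * F x\<bar> \<le> 2 * L * \<phi> x" for x
  proof (cases "0 \<le> x")
    case True
    then show ?thesis
      using half_line_bounds[OF F(1,3) c_bdd lip growth] by blast
  next
    case False
    \<comment> \<open>For negative \<open>x\<close> the reflected function satisfies the same
      hypotheses, with \<open>h (- t)\<close> for \<open>h t\<close>.\<close>
    have d: "((\<lambda>t. - F (- t)) has_real_derivative (h (- t) - c) * \<phi> t) (at t)" for t
    proof -
      have "((\<lambda>t. F (- t)) has_real_derivative (h (- t) - c) * \<phi> (- t) * - 1) (at t)"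
        by (rule DERIV_chain2[where g = uminus]) (auto intro!: F(1) derivative_eq_intros)
      from DERIV_minus[OF this] show ?thesis
        by (simp add: phi_minus)
    qed
    have l: "((\<lambda>t. - F (- t)) \<longlongrightarrow> 0) at_top"
      using tendsto_minus[OF F(2)[unfolded filterlim_at_bot_mirror]] by simp
    have "\<bar>h (- s) - h (- t)\<bar> \<le> L * \<bar>s - t\<bar>" for s t
      using lip[of "- s" "- t"] by (simp add: abs_minus_commute)
    moreover have "\<bar>h (- t) - c\<bar> \<le> L * (\<bar>t\<bar> + 1)" for t
      using growth[of "- t"] by simp
    ultimately show ?thesis
      using half_line_bounds[OF d l c_bdd, of L "- x"] False phi_minus[of x] by simp
  qed
  define f where "f x = F x / \<phi> x" for x
  define f' where "f' x = x * f x + h x - c" for x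
  have phi_f: "F x = f x * \<phi> x" for x
    using phi_pos[of x] by (simp add: f_def)
  have scale: "\<bar>a\<bar> \<le> K" if "\<bar>a * \<phi> x\<bar> \<le> K * \<phi> x" for a K x
    using that phi_pos[of x] by (simp add: abs_mult)
  have xf: "\<bar>x * f x\<bar> \<le> 2 * B" for x
    by (rule scale[of _ x]) (use bounds[of x] in \<open>simp add: phi_f mult.assoc\<close>)
  show ?thesis
  proof
    show "(f has_real_derivative f' x) (at x)" for x
      unfolding f_def[abs_def]
      by (rule derivative_eq_intros F(1) has_real_derivative_phi refl)+
        (use phi_pos[of x] in \<open>auto simp: f'_def f_def field_simps power2_eq_square\<close>)
    show "f' x = x * f x + h x - c" for x
      by (rule f'_def)
    show "\<bar>f' x\<bar> \<le> 4 * B" for x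
      using xf[of x] c_bdd[of x] unfolding f'_def by linarith
    show "\<bar>f x\<bar> \<le> 5 / 2 * L" for x
      by (rule scale[of _ x]) (use bounds[of x] in \<open>simp add: phi_f\<close>)
    show "\<bar>f' x\<bar> \<le> 2 * L" for x
      by (rule scale[of _ x]) (use bounds[of x] in \<open>simp add: phi_f f'_def algebra_simps\<close>)
  qed
qed

section \<open>Normal approximation\<close>

lemma taylor_lipschitz_deriv:
  fixes f f' :: "real \<Rightarrow> real"
  assumes deriv: "\<And>y. (f has_real_derivative f' y) (at y)"
    and lip: "\<And>t. \<bar>f' (x + t) - f' x\<bar> \<le> C * \<bar>t\<bar>"
  shows "\<bar>f (x + d) - f x - d * f' x\<bar> \<le> C / 2 * d\<^sup>2"
proof -
  have "s * (f (x + d) - f x - d * f' x) \<le> C / 2 * d\<^sup>2" if s: "\<bar>s\<bar> = 1" for s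
  proof -
    let ?g = "\<lambda>t. s * (f (x + t * d) - f x - t * d * f' x) - C / 2 * d\<^sup>2 * t\<^sup>2"
    have "?g 1 \<le> ?g 0"
    proof (rule DERIV_nonpos_imp_nonincreasing[where f = ?g and a = 0 and b = 1])
      fix t :: real assume t: "0 \<le> t" "t \<le> 1"
      let ?g' = "s * (d * (f' (x + t * d) - f' x)) - C * d\<^sup>2 * t"
      have "((\<lambda>t. f (x + t * d)) has_real_derivative f' (x + t * d) * d) (at t)"
        by (rule DERIV_chain2[OF deriv]) (auto intro!: derivative_eq_intros)
      then have "(?g has_real_derivative ?g') (at t)"
        by (auto intro!: derivative_eq_intros simp: algebra_simps)
      moreover have "?g' \<le> 0"
      proof -
        have "s * (d * (f' (x + t * d) - f' x)) \<le> \<bar>s * (d * (f' (x + t * d) - f' x))\<bar>"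
          by (rule abs_ge_self)
        also have "\<dots> = \<bar>d\<bar> * \<bar>f' (x + t * d) - f' x\<bar>"
          using s by (simp add: abs_mult)
        also have "\<dots> \<le> \<bar>d\<bar> * (C * \<bar>t * d\<bar>)"
          by (intro mult_left_mono lip) simp
        also have "\<dots> = C * d\<^sup>2 * t"
          using t by (simp add: abs_mult power2_eq_square)
        finally show ?thesis by simp
      qed
      ultimately show "\<exists>y. (?g has_real_derivative y) (at t) \<and> y \<le> 0"
        by blast
    qed simp
    then show ?thesis by simp
  qed
  from this[of 1] this[of "- 1"]
  have "f (x + d) - f x - d * f' x \<le> C / 2 * d\<^sup>2" "- (f (x + d) - f x - d * f' x) \<le> C / 2 * d\<^sup>2"
    by simp_all
  then show ?thesis by (rule abs_leI)
qed

context mallows_le_1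
begin

text \<open>The term with \<open>B\<close> comes from the fluctuation of \<open>U\<close> about its
  mean, the term with \<open>L\<close> from the second-order remainder \<open>R\<close>.\<close>

lemma stein_bound:
  fixes h :: "real \<Rightarrow> real"
  assumes bdd: "\<And>t. \<bar>h t\<bar> \<le> B"
    and lip: "\<And>s t. \<bar>h s - h t\<bar> \<le> L * \<bar>s - t\<bar>"
    and var: "\<sigma>\<^sup>2 = E (\<lambda>v. (Y v - E Y)\<^sup>2)" "\<sigma> \<ge> 0"
  shows "\<bar>E (\<lambda>v. h ((Y v - E Y) / \<sigma>)) - (\<integral>t. \<phi> t * h t \<partial>lborel)\<bar>
    \<le> (331 * B + 167 * L / sqrt q) / sqrt (real (n - 1))"
proof -
  define c where "c = (\<integral>t. \<phi> t * h t \<partial>lborel)"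
  define m where "m = real (n - 1)"
  have m: "m \<ge> 1" using n by (simp add: m_def)
  have p: "p > 0" "q / 2 \<le> p"
    using q q_le by (auto simp: p_def divide_simps)
  have L: "0 \<le> L" using lip[of 0 1] by simp
  have B: "0 \<le> B" using bdd[of 0] by linarith
  have EU: "E U \<ge> m / 6"
    using E_U_ge by (simp add: m_def)
  have s2: "\<sigma>\<^sup>2 = 2 * p * E U"
    using var(1) variance_Y by simp
  \<comment> \<open>This lower bound on the variance also excludes
    \<open>\<sigma> = 0\<close>.\<close>
  have pm: "p * m \<le> 3 * \<sigma>\<^sup>2"
    using mult_left_mono[OF EU, of "6 * p"] p by (simp add: s2)
  have "p * m > 0" using p m by simp
  then have "\<sigma> \<noteq> 0" using pm by auto
  then have s: "\<sigma> > 0" using var(2) by simp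
  obtain f f' where f: "\<And>x. (f has_real_derivative f' x) (at x)"
    "\<And>x. f' x = x * f x + h x - c"
    "\<And>x. \<bar>f' x\<bar> \<le> 4 * B" "\<And>x. \<bar>f' x\<bar> \<le> 2 * L" "\<And>x. \<bar>f x\<bar> \<le> 5 / 2 * L"
    using stein_solution[OF bdd lip c_def] by blast
  define W where "W = (\<lambda>v. (Y v - E Y) / \<sigma>)"
  define R where "R = (\<lambda>i v. f (W v + change i v / \<sigma>) - f (W v) - change i v / \<sigma> * f' (W v))"
  \<comment> \<open>Differences are taken in the Stein equation: \<open>5 / 2\<close> comes from the
    size of \<open>f\<close>, \<open>2 * |x|\<close> from its Lipschitz constant and 1 from
    \<open>h\<close>.\<close>
  have f'_lip: "\<bar>f' (x + t) - f' x\<bar> \<le> L * (7 / 2 + 2 * \<bar>x\<bar>) * \<bar>t\<bar>" for x t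
  proof -
    have "norm (f (x + t) - f x) \<le> 2 * L * norm (x + t - x)"
      by (rule field_differentiable_bound[of UNIV f f']) (use f in \<open>auto simp: real_norm_def\<close>)
    then have "\<bar>f (x + t) - f x\<bar> \<le> 2 * L * \<bar>t\<bar>" by simp
    then have 1: "\<bar>x * (f (x + t) - f x)\<bar> \<le> \<bar>x\<bar> * (2 * L * \<bar>t\<bar>)"
      unfolding abs_mult by (rule mult_left_mono) simp
    have 2: "\<bar>t * f (x + t)\<bar> \<le> \<bar>t\<bar> * (5 / 2 * L)"
      unfolding abs_mult by (rule mult_left_mono[OF f(5)]) simp
    have 3: "\<bar>h (x + t) - h x\<bar> \<le> L * \<bar>t\<bar>"
      using lip[of "x + t" x] by simp
    have "f' (x + t) - f' x = t * f (x + t) + x * (f (x + t) - f x) + (h (x + t) - h x)"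
      unfolding f(2) by (simp add: algebra_simps)
    then have "\<bar>f' (x + t) - f' x\<bar> \<le> \<bar>t\<bar> * (5 / 2 * L) + \<bar>x\<bar> * (2 * L * \<bar>t\<bar>) + L * \<bar>t\<bar>"
      using 1 2 3 by linarith
    also have "\<dots> = L * (7 / 2 + 2 * \<bar>x\<bar>) * \<bar>t\<bar>"
      by (simp add: algebra_simps)
    finally show ?thesis .
  qed
  have R_le: "\<bar>asc i v * R i v\<bar> \<le> 2 / \<sigma>\<^sup>2 * (L * (7 / 2 + 2 * \<bar>W v\<bar>))" for i v
  proof -
    have "\<bar>asc i v * R i v\<bar> \<le> \<bar>R i v\<bar>"
      using asc_cases[of i v] by auto
    also have "\<dots> \<le> L * (7 / 2 + 2 * \<bar>W v\<bar>) / 2 * (change i v / \<sigma>)\<^sup>2"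
      unfolding R_def by (rule taylor_lipschitz_deriv[OF f(1) f'_lip])
    also have "\<dots> \<le> L * (7 / 2 + 2 * \<bar>W v\<bar>) / 2 * (4 / \<sigma>\<^sup>2)"
    proof (rule mult_left_mono)
      have "(change i v)\<^sup>2 \<le> 2\<^sup>2"
        using change_bound[of i v] by (intro power2_le_iff_abs_le[THEN iffD2]) auto
      then show "(change i v / \<sigma>)\<^sup>2 \<le> 4 / \<sigma>\<^sup>2"
        by (simp add: power_divide divide_right_mono)
    qed (use L in simp)
    also have "\<dots> = 2 / \<sigma>\<^sup>2 * (L * (7 / 2 + 2 * \<bar>W v\<bar>))"
    proof -
      have "a / 2 * (4 / b) = 2 / b * a" for a b :: real by simp
      then show ?thesis .
    qed
    finally show ?thesis .
  qed
  have EW: "E (\<lambda>v. \<bar>W v\<bar>) \<le> 1"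
  proof -
    have "E (\<lambda>v. (W v)\<^sup>2) = E (\<lambda>v. 1 / \<sigma>\<^sup>2 * (Y v - E Y)\<^sup>2)"
      by (simp add: W_def power_divide)
    also have "\<dots> = 1 / \<sigma>\<^sup>2 * \<sigma>\<^sup>2"
      unfolding E_cmult var(1) ..
    finally have "E (\<lambda>v. (W v)\<^sup>2) = 1" using s by simp
    then show ?thesis using E_abs_le_sqrt[of W] by simp
  qed
  \<comment> \<open>With \<open>E |W| <= 1\<close> the factor \<open>7 / 2 + 2 * |W|\<close>
    averages to at most \<open>11 / 2\<close>.\<close>
  have R_sum: "\<bar>\<Sum>i=1..n - 1. E (\<lambda>v. asc i v * R i v)\<bar> \<le> m * (2 / \<sigma>\<^sup>2 * (L * (11 / 2)))"
  proof -
    have "\<bar>E (\<lambda>v. asc i v * R i v)\<bar> \<le> 2 / \<sigma>\<^sup>2 * (L * (11 / 2))" for i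
    proof -
      have "\<bar>E (\<lambda>v. asc i v * R i v)\<bar> \<le> E (\<lambda>v. \<bar>asc i v * R i v\<bar>)"
        by (rule E_abs)
      also have "\<dots> \<le> E (\<lambda>v. 2 / \<sigma>\<^sup>2 * (L * (7 / 2 + 2 * \<bar>W v\<bar>)))"
        by (rule E_mono) (rule R_le)
      also have "\<dots> = 2 / \<sigma>\<^sup>2 * (L * (7 / 2 + 2 * E (\<lambda>v. \<bar>W v\<bar>)))"
        by (simp only: E_cmult E_add E_const)
      also have "\<dots> \<le> 2 / \<sigma>\<^sup>2 * (L * (11 / 2))"
        using EW L by (intro mult_left_mono) auto
      finally show ?thesis .
    qed
    then have "(\<Sum>i=1..n - 1. \<bar>E (\<lambda>v. asc i v * R i v)\<bar>) \<le>
        (\<Sum>i=1..n - 1. 2 / \<sigma>\<^sup>2 * (L * (11 / 2)))"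
      by (intro sum_mono)
    also have "\<dots> = m * (2 / \<sigma>\<^sup>2 * (L * (11 / 2)))"
      by (simp add: m_def)
    finally show ?thesis
      by (rule order_trans[OF sum_abs])
  qed
  have EWf: "E (\<lambda>v. W v * f (W v)) =
      2 * p / \<sigma>\<^sup>2 * E (\<lambda>v. U v * f' (W v)) + 2 * p / \<sigma> * (\<Sum>i=1..n - 1. E (\<lambda>v. asc i v * R i v))"
  proof -
    have "E (\<lambda>v. W v * f (W v)) = 1 / \<sigma> * E (\<lambda>v. (Y v - E Y) * f ((Y v - E Y) / \<sigma>))"
      unfolding E_cmult[symmetric] W_def by simp
    also have "E (\<lambda>v. (Y v - E Y) * f ((Y v - E Y) / \<sigma>)) =
        2 * p * (\<Sum>i=1..n - 1. E (\<lambda>v. asc i v * (f ((Y v + change i v - E Y) / \<sigma>) - f ((Y v - E Y) / \<sigma>))))"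
      by (rule E_Y_stein)
    also have "(\<Sum>i=1..n - 1. E (\<lambda>v. asc i v * (f ((Y v + change i v - E Y) / \<sigma>) - f ((Y v - E Y) / \<sigma>)))) =
        (\<Sum>i=1..n - 1. E (\<lambda>v. 1 / \<sigma> * (change i v * f' (W v)) + asc i v * R i v))"
    proof (rule sum.cong[OF refl], rule E_cong)
      fix i v
      have W: "(Y v + change i v - E Y) / \<sigma> = W v + change i v / \<sigma>" "(Y v - E Y) / \<sigma> = W v"
        by (simp_all add: W_def add_divide_distrib diff_divide_distrib)
      have "asc i v * change i v = change i v"
        by (rule asc_mult_change)
      then have "asc i v * (change i v / \<sigma> * f' (W v)) = 1 / \<sigma> * (change i v * f' (W v))"
        by (metis (no_types, opaque_lifting) mult.assoc mult.commute times_divide_eq_left mult_1)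
      then show "asc i v * (f ((Y v + change i v - E Y) / \<sigma>) - f ((Y v - E Y) / \<sigma>)) =
          1 / \<sigma> * (change i v * f' (W v)) + asc i v * R i v"
        unfolding W R_def by (simp add: right_diff_distrib)
    qed
    also have "\<dots> = 1 / \<sigma> * E (\<lambda>v. U v * f' (W v)) + (\<Sum>i=1..n - 1. E (\<lambda>v. asc i v * R i v))"
      by (simp only: E_add E_cmult sum.distrib sum_distrib_left[symmetric] E_sum[symmetric]
          sum_distrib_right[symmetric] U_def[symmetric])
    finally show ?thesis
      using s by (simp add: field_simps power2_eq_square)
  qed
  have "E (\<lambda>v. h (W v)) - c = E (\<lambda>v. f' (W v) - W v * f (W v))"
  proof -
    have "(\<lambda>v. f' (W v) - W v * f (W v)) = (\<lambda>v. h (W v) - c)"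
      unfolding f(2) by auto
    then show ?thesis by (simp add: E_diff)
  qed
  also have "\<dots> = (E (\<lambda>v. f' (W v)) - 2 * p / \<sigma>\<^sup>2 * E (\<lambda>v. U v * f' (W v)))
      - 2 * p / \<sigma> * (\<Sum>i=1..n - 1. E (\<lambda>v. asc i v * R i v))"
    unfolding E_diff EWf by simp
  finally have split: "\<bar>E (\<lambda>v. h (W v)) - c\<bar> \<le>
      \<bar>E (\<lambda>v. f' (W v)) - 2 * p / \<sigma>\<^sup>2 * E (\<lambda>v. U v * f' (W v))\<bar>
      + \<bar>2 * p / \<sigma> * (\<Sum>i=1..n - 1. E (\<lambda>v. asc i v * R i v))\<bar>"
    by linarith
  have EU0: "E U > 0" using EU m by linarith
  have ratio: "2 * p / \<sigma>\<^sup>2 = 1 / E U"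
    unfolding s2 using p EU0 by simp
  have first: "\<bar>E (\<lambda>v. f' (W v)) - 2 * p / \<sigma>\<^sup>2 * E (\<lambda>v. U v * f' (W v))\<bar> \<le> 331 * B / sqrt m"
  proof -
    have "E (\<lambda>v. f' (W v)) - 2 * p / \<sigma>\<^sup>2 * E (\<lambda>v. U v * f' (W v)) =
        1 / E U * E (\<lambda>v. - (f' (W v) * (U v - E U)))"
    proof -
      have "(\<lambda>v. - (f' (W v) * (U v - E U))) = (\<lambda>v. E U * f' (W v) - U v * f' (W v))"
        by (auto simp: algebra_simps)
      then have "E (\<lambda>v. - (f' (W v) * (U v - E U))) = E U * E (\<lambda>v. f' (W v)) - E (\<lambda>v. U v * f' (W v))"
        by (simp only: E_diff E_cmult)
      then show ?thesis
        unfolding ratio using EU0 by (simp add: right_diff_distrib)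
    qed
    also have "\<bar>\<dots>\<bar> \<le> 1 / E U * (4 * B * sqrt (56 * m))"
    proof -
      have "\<bar>E (\<lambda>v. - (f' (W v) * (U v - E U)))\<bar> \<le> E (\<lambda>v. \<bar>- (f' (W v) * (U v - E U))\<bar>)"
        by (rule E_abs)
      also have "\<dots> \<le> E (\<lambda>v. 4 * B * \<bar>U v - E U\<bar>)"
        by (rule E_mono) (use f(3) in \<open>simp add: abs_mult mult_right_mono\<close>)
      also have "\<dots> = 4 * B * E (\<lambda>v. \<bar>U v - E U\<bar>)"
        by (rule E_cmult)
      also have "\<dots> \<le> 4 * B * sqrt (56 * m)"
      proof (rule mult_left_mono)
        have "E (\<lambda>v. \<bar>U v - E U\<bar>) \<le> sqrt (E (\<lambda>v. (U v - E U)\<^sup>2))"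
          by (rule E_abs_le_sqrt)
        also have "\<dots> \<le> sqrt (56 * m)"
          using variance_U by (simp add: m_def)
        finally show "E (\<lambda>v. \<bar>U v - E U\<bar>) \<le> sqrt (56 * m)" .
      qed (use B in simp)
      finally show ?thesis
        using EU0 by (simp add: abs_mult divide_right_mono)
    qed
    also have "\<dots> \<le> 6 / m * (4 * B * sqrt (56 * m))"
    proof (rule mult_right_mono)
      show "1 / E U \<le> 6 / m"
        using EU EU0 m by (simp add: divide_simps)
    qed (use B m in simp)
    also have "\<dots> = 24 * sqrt 56 * B / sqrt m"
    proof -
      have "m = sqrt m * sqrt m" "sqrt m > 0" using m by auto
      then show ?thesis
        by (simp add: real_sqrt_mult field_simps)
    qed
    also have "\<dots> \<le> 331 * B / sqrt m"
    proof -
      have "sqrt 56 \<le> 8" by (rule real_le_lsqrt) auto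
      then have "24 * sqrt 56 * B \<le> 331 * B"
        using B by (intro mult_right_mono) auto
      then show ?thesis using m by (intro divide_right_mono) auto
    qed
    finally show ?thesis .
  qed
  have second: "\<bar>2 * p / \<sigma> * (\<Sum>i=1..n - 1. E (\<lambda>v. asc i v * R i v))\<bar> \<le> 167 * L / sqrt q / sqrt m"
  proof -
    have "\<bar>2 * p / \<sigma> * (\<Sum>i=1..n - 1. E (\<lambda>v. asc i v * R i v))\<bar> \<le>
        2 * p / \<sigma> * (m * (2 / \<sigma>\<^sup>2 * (L * (11 / 2))))"
      using mult_left_mono[OF R_sum, of "2 * p / \<sigma>"] p s by (simp add: abs_mult)
    also have "\<dots> = p * m * (22 * L / (\<sigma>\<^sup>2 * \<sigma>))"
      by (simp add: field_simps)
    also have "\<dots> \<le> 3 * \<sigma>\<^sup>2 * (22 * L / (\<sigma>\<^sup>2 * \<sigma>))"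
      using pm L s by (intro mult_right_mono) auto
    also have "\<dots> = 66 * L / \<sigma>"
      using s by simp
    also have "\<dots> \<le> 167 * L / (sqrt q * sqrt m)"
    proof -
      \<comment> \<open>Rounding \<open>sqrt 6\<close> up to \<open>5 / 2\<close> gives
        \<open>66 * 5 / 2 = 165\<close>, below 167.\<close>
      have "q * m \<le> 6 * \<sigma>\<^sup>2"
        using pm mult_right_mono[OF p(2), of m] m by linarith
      also have "\<dots> \<le> (5 / 2 * \<sigma>)\<^sup>2"
        by (simp add: power_mult_distrib power2_eq_square)
      finally have "sqrt (q * m) \<le> 5 / 2 * \<sigma>"
        using s by (intro real_le_lsqrt) auto
      then have "sqrt q * sqrt m \<le> 5 / 2 * \<sigma>"
        by (simp add: real_sqrt_mult)
      then have "66 * (sqrt q * sqrt m) \<le> 167 * \<sigma>"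
        using s by linarith
      from mult_left_mono[OF this L]
      have "L * (66 * (sqrt q * sqrt m)) \<le> L * (167 * \<sigma>)" .
      then show ?thesis
        using s q m by (simp add: divide_simps mult_ac)
    qed
    finally show ?thesis by simp
  qed
  have "331 * B / sqrt m + 167 * L / sqrt q / sqrt m = (331 * B + 167 * L / sqrt q) / sqrt m"
    by (simp add: add_divide_distrib)
  then show ?thesis
    using split first second unfolding W_def c_def m_def by linarith
qed

end

section \<open>Reversal and the range \<open>q > 1\<close>\<close>

context mallows
begin

text \<open>Reversal exchanges ascents and descents: for \<open>v\<close> at mirrored places, and
  for the inverse, whose values are reversed, at the same places.\<close>

lemma Y_flip:
  assumes v: "v permutes {1..n}"
  shows "Y (v \<circ> flip n) = 2 * real (n - 1) - Y v"
proof -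
  have inv: "inv (v \<circ> flip n) = flip n \<circ> inv v"
  proof -
    have "inv (flip n) = flip n"
      by (rule inv_unique_comp) (auto simp: fun_eq_iff)
    then show ?thesis
      using permutes_bij[OF v] permutes_bij[OF flip_permutes] by (simp add: o_inv_distrib)
  qed
  have 1: "real (des n (v \<circ> flip n)) = real (n - 1) - real (des n v)"
  proof -
    have "(\<Sum>j=1..n - 1. dsc j (v \<circ> flip n)) = (\<Sum>j=1..n - 1. asc (n - j) v)"
    proof (rule sum.cong[OF refl])
      fix j assume j: "j \<in> {1..n - 1}"
      then have "flip n j = n - j + 1" "flip n (j + 1) = n - j"
        by (auto simp: flip_def)
      then show "dsc j (v \<circ> flip n) = asc (n - j) v"
        by (simp add: dsc_def asc_def)
    qed
    also have "\<dots> = (\<Sum>j=1..n - 1. asc j v)"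
      by (rule sum.reindex_bij_witness[of _ "\<lambda>j. n - j" "\<lambda>j. n - j"]) auto
    also have "\<dots> = (\<Sum>j=1..n - 1. 1 - dsc j v)"
      using asc_dsc[OF v] by simp
    finally show ?thesis
      by (simp add: des_sum sum_subtractf)
  qed
  have 2: "real (des n (inv (v \<circ> flip n))) = real (n - 1) - real (des n (inv v))"
  proof -
    have "(\<Sum>j=1..n - 1. dsc j (flip n \<circ> inv v)) = (\<Sum>j=1..n - 1. 1 - dsc j (inv v))"
    proof (rule sum.cong[OF refl])
      fix j assume j: "j \<in> {1..n - 1}"
      have v': "inv v permutes {1..n}"
        by (rule permutes_inv[OF v])
      have "inv v j \<in> {1..n}" "inv v (j + 1) \<in> {1..n}"
        using permutes_in_image[OF v', of j] permutes_in_image[OF v', of "j + 1"] j by auto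
      then have "dsc j (flip n \<circ> inv v) = asc j (inv v)"
        using flip_less by (simp add: dsc_def asc_def)
      then show "dsc j (flip n \<circ> inv v) = 1 - dsc j (inv v)"
        using asc_dsc[OF v'] by simp
    qed
    then show ?thesis
      by (simp add: inv des_sum sum_subtractf)
  qed
  show ?thesis
    unfolding Y_def of_nat_add 1 2 by simp
qed

text \<open>For \<open>q > 1\<close> the centred \<open>Y\<close> is distributed as minus the
  centred \<open>Y\<close> for \<open>1 / q\<close>, so \<open>stein_bound\<close> is applied to
  \<open>h (- t)\<close>; the normal law is symmetric.\<close>

lemma mallows_clt:
  fixes h :: "real \<Rightarrow> real"
  assumes bdd: "\<And>t. \<bar>h t\<bar> \<le> B"
    and lip: "\<And>s t. \<bar>h s - h t\<bar> \<le> L * \<bar>s - t\<bar>"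
    and var: "\<sigma>\<^sup>2 = E (\<lambda>v. (Y v - E Y)\<^sup>2)" "\<sigma> \<ge> 0"
  shows "\<bar>E (\<lambda>v. h ((Y v - E Y) / \<sigma>)) - (\<integral>t. \<phi> t * h t \<partial>lborel)\<bar>
    \<le> (331 * B + 167 * L * max (q powr (- 1 / 2)) (q powr (1 / 2))) * (real n - 1) powr (- 1 / 2)"
proof -
  have n1: "(real n - 1) powr (- 1 / 2) = 1 / sqrt (real (n - 1))"
    using n by (simp add: powr_minus_divide powr_half_sqrt of_nat_diff)
  have L: "0 \<le> L" using lip[of 0 1] by simp
  have final: "(331 * B + 167 * L / sqrt r) / sqrt (real (n - 1)) \<le>
      (331 * B + 167 * L * max (q powr (- 1 / 2)) (q powr (1 / 2))) * (real n - 1) powr (- 1 / 2)"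
    if "1 / sqrt r \<le> max (q powr (- 1 / 2)) (q powr (1 / 2))" for r
    unfolding n1 using mult_left_mono[OF that, of "167 * L"] L by (simp add: divide_right_mono)
  show ?thesis
  proof (cases "q \<le> 1")
    case True
    interpret mallows_le_1 n q
      by unfold_locales (rule True)
    have "1 / sqrt q \<le> max (q powr (- 1 / 2)) (q powr (1 / 2))"
      using q by (simp add: powr_minus_divide powr_half_sqrt)
    from order_trans[OF stein_bound[OF bdd lip var] final[OF this]] show ?thesis .
  next
    case False
    interpret R: mallows_le_1 n "1 / q"
      by unfold_locales (use n q False in auto)
    let ?E = "mallows_E n (1 / q)"
    have EY: "E Y = 2 * real (n - 1) - ?E Y"
    proof -
      have "E Y = ?E (\<lambda>v. Y (v \<circ> flip n))"
        by (rule E_flip[symmetric])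
      also have "\<dots> = ?E (\<lambda>v. 2 * real (n - 1) - Y v)"
        by (rule R.E_cong) (rule Y_flip)
      finally show ?thesis by (simp add: R.E_diff)
    qed
    have transfer: "E (\<lambda>v. G (Y v - E Y)) = ?E (\<lambda>v. G (- (Y v - ?E Y)))" for G
    proof -
      have "E (\<lambda>v. G (Y v - E Y)) = ?E (\<lambda>v. G (Y (v \<circ> flip n) - E Y))"
        by (rule E_flip[symmetric])
      also have "\<dots> = ?E (\<lambda>v. G (- (Y v - ?E Y)))"
        by (rule R.E_cong) (simp add: Y_flip EY)
      finally show ?thesis .
    qed
    have var': "\<sigma>\<^sup>2 = ?E (\<lambda>v. (Y v - ?E Y)\<^sup>2)"
      unfolding var(1) transfer[of "\<lambda>x. x\<^sup>2"] by (simp only: power2_minus)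
    have lip': "\<bar>h (- s) - h (- t)\<bar> \<le> L * \<bar>s - t\<bar>" for s t
      using lip[of "- s" "- t"] by (simp add: abs_minus_commute)
    have "(\<integral>t. \<phi> t * h t \<partial>lborel) = (\<integral>t. \<phi> t * h (- t) \<partial>lborel)"
      using lborel_integral_real_affine[of "- 1" "\<lambda>t. \<phi> t * h t" 0] by (simp add: phi_minus)
    moreover have "E (\<lambda>v. h ((Y v - E Y) / \<sigma>)) = ?E (\<lambda>v. h (- ((Y v - ?E Y) / \<sigma>)))"
      unfolding transfer[of "\<lambda>x. h (x / \<sigma>)"] by (simp only: minus_divide_left)
    moreover have "1 / sqrt (1 / q) \<le> max (q powr (- 1 / 2)) (q powr (1 / 2))"
      using q by (simp add: powr_half_sqrt real_sqrt_divide)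
    ultimately show ?thesis
      using order_trans[OF R.stein_bound[of "\<lambda>t. h (- t)", OF bdd lip' var' var(2)] final] by simp
  qed
qed

end

text \<open>An expectation is a finite sum over the values of \<open>w\<close>; the constant
  function 1 identifies the proportionality constant.\<close>

lemma mallows_distributed_expectation:
  assumes n: "n \<ge> 2" and q: "q > 0" and M: "prob_space M" and w: "mallows_distributed M w n q"
  shows "prob_space.expectation M (\<lambda>\<omega>. F (w \<omega>)) = mallows_E n q F"
proof -
  interpret prob_space M by (rule M)
  let ?P = "{v. v permutes {1..n}}"
  interpret mallows n q by unfold_locales (use n q in auto)
  have meas: "w \<in> measurable M (count_space ?P)"
    using w by (simp add: mallows_distributed_def)
  obtain c where c: "\<And>v. v permutes {1..n} \<Longrightarrow> measure M {\<omega> \<in> space M. w \<omega> = v} = c * q ^ perm_length n v"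
    using w by (auto simp: mallows_distributed_def)
  have sets: "{\<omega> \<in> space M. w \<omega> = v} \<in> sets M" if "v \<in> ?P" for v
  proof -
    have "w -` {v} \<inter> space M \<in> sets M"
      using meas that by (intro measurable_sets[of w M "count_space ?P"]) auto
    moreover have "w -` {v} \<inter> space M = {\<omega> \<in> space M. w \<omega> = v}" by auto
    ultimately show ?thesis by simp
  qed
  have fin: "finite ?P" by (rule finite_perms)
  have ex: "expectation (\<lambda>\<omega>. F (w \<omega>)) = c * (\<Sum>v\<in>?P. q ^ perm_length n v * F v)" for F :: "(nat \<Rightarrow> nat) \<Rightarrow> real"
  proof -
    have "expectation (\<lambda>\<omega>. F (w \<omega>)) =
        expectation (\<lambda>\<omega>. \<Sum>v\<in>?P. F v * indicator {\<omega> \<in> space M. w \<omega> = v} \<omega>)"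
    proof (rule Bochner_Integration.integral_cong[OF refl])
      fix \<omega> assume \<omega>: "\<omega> \<in> space M"
      then have "w \<omega> \<in> ?P"
        using measurable_space[OF meas] by simp
      have "(\<Sum>v\<in>?P. F v * indicator {\<omega> \<in> space M. w \<omega> = v} \<omega>) = (\<Sum>v\<in>?P. if v = w \<omega> then F v else 0)"
        using \<omega> by (intro sum.cong) (auto simp: indicator_def)
      also have "\<dots> = F (w \<omega>)"
        using fin \<open>w \<omega> \<in> ?P\<close> by (subst sum.delta) auto
      finally show "F (w \<omega>) = (\<Sum>v\<in>?P. F v * indicator {\<omega> \<in> space M. w \<omega> = v} \<omega>)" by simp
    qed
    also have "\<dots> = (\<Sum>v\<in>?P. expectation (\<lambda>\<omega>. F v * indicator {\<omega> \<in> space M. w \<omega> = v} \<omega>))"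
    proof (rule Bochner_Integration.integral_sum)
      fix v assume "v \<in> ?P"
      then show "integrable M (\<lambda>\<omega>. F v * indicator {\<omega> \<in> space M. w \<omega> = v} \<omega>)"
        using sets emeasure_finite by (intro integrable_mult_right integrable_real_indicator) (auto simp: less_top[symmetric])
    qed
    also have "\<dots> = (\<Sum>v\<in>?P. c * (q ^ perm_length n v * F v))"
    proof (rule sum.cong[OF refl])
      fix v assume v: "v \<in> ?P"
      have "expectation (\<lambda>\<omega>. F v * indicator {\<omega> \<in> space M. w \<omega> = v} \<omega>) =
          F v * measure M {\<omega> \<in> space M. w \<omega> = v}"
        using sets[OF v] by simp
      then show "expectation (\<lambda>\<omega>. F v * indicator {\<omega> \<in> space M. w \<omega> = v} \<omega>) = c * (q ^ perm_length n v * F v)"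
        using c v by simp
    qed
    finally show ?thesis by (simp add: sum_distrib_left)
  qed
  have "c * (\<Sum>v\<in>?P. q ^ perm_length n v) = 1"
    using ex[of "\<lambda>_. 1"] prob_space by simp
  then have "c = 1 / (\<Sum>v\<in>?P. q ^ perm_length n v)"
    using total_pos by (simp add: field_simps)
  then show ?thesis
    unfolding ex mallows_E_def by simp
qed

lemma piecewise_C1_lipschitz:
  assumes h: "piecewise_C1 h"
    and bound: "\<And>x. h differentiable (at x) \<Longrightarrow> \<bar>deriv h x\<bar> \<le> L" and L: "0 \<le> L"
  shows "\<bar>h s - h t\<bar> \<le> L * \<bar>s - t\<bar>"
proof -
  have *: "\<bar>h b - h a\<bar> \<le> L * (b - a)" if ab: "a \<le> b" for a b
  proof -
    obtain S where S: "finite S" "h C1_differentiable_on ({a..b} - S)" and cont: "continuous_on {a..b} h"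
      using h unfolding piecewise_C1_def piecewise_C1_differentiable_on_def by blast
    \<comment> \<open>The value 0 at points of non-differentiability keeps the bound
      \<open>L\<close> valid everywhere; inside the interval such points lie in the finite set
      \<open>S\<close>.\<close>
    let ?d = "\<lambda>x. if h differentiable (at x) then deriv h x else 0"
    have "(?d has_integral (h b - h a)) {a..b}"
    proof (rule fundamental_theorem_of_calculus_interior_strong[OF S(1) ab _ cont])
      fix x assume x: "x \<in> {a<..<b} - S"
      then have "h differentiable (at x)"
        using S(2) by (auto simp: C1_differentiable_on_eq)
      then show "(h has_vector_derivative ?d x) (at x)"
        by (simp add: DERIV_deriv_iff_real_differentiable has_real_derivative_iff_has_vector_derivative[symmetric])
    qed
    then have "norm (h b - h a) \<le> L * measure lborel (cbox a b)"
      by (intro has_integral_bound[of L ?d]) (use L bound in \<open>auto simp: cbox_interval\<close>)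
    then show ?thesis using ab by simp
  qed
  show ?thesis
    using *[of s t] *[of t s] by (cases "s \<le> t") (auto simp: abs_minus_commute)
qed

theorem theorem1p1:
  fixes n :: nat and q \<mu> \<sigma> :: real
    and M :: "'a measure" and w :: "'a \<Rightarrow> nat \<Rightarrow> nat"
    and N :: "'b measure" and Z :: "'b \<Rightarrow> real"
    and h :: "real \<Rightarrow> real"
  assumes "n \<ge> 2" and "q > 0"
    and "prob_space M" and "mallows_distributed M w n q"
    and "\<mu> = prob_space.expectation M (\<lambda>\<omega>. real (des n (w \<omega>) + des n (inv (w \<omega>))))"
    and "\<sigma>\<^sup>2 = prob_space.variance M (\<lambda>\<omega>. real (des n (w \<omega>) + des n (inv (w \<omega>))))"
    and "\<sigma> \<ge> 0"
    and "prob_space N" and "distributed N lborel Z std_normal_density"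
    and "piecewise_C1 h"
  shows "ennreal \<bar>prob_space.expectation M
                    (\<lambda>\<omega>. h ((real (des n (w \<omega>) + des n (inv (w \<omega>))) - \<mu>) / \<sigma>))
                  - prob_space.expectation N (\<lambda>\<omega>. h (Z \<omega>))\<bar>
         \<le> (331 * sup_norm h
             + 167 * deriv_sup_norm h * ennreal (max (q powr (- 1 / 2)) (q powr (1 / 2))))
           * ennreal ((real n - 1) powr (- 1 / 2))"
proof -
  let ?mx = "max (q powr (- 1 / 2)) (q powr (1 / 2))" and ?r = "(real n - 1) powr (- 1 / 2)"
  \<comment> \<open>Positivity matters when a norm is infinite: only then does the product stay
    infinite, as \<open>0 * \<top> = 0\<close> in \<open>ennreal\<close>.\<close>
  have pos: "?mx > 0" "?r > 0"
    using assms(1,2) by (auto simp: less_max_iff_disj)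
  show ?thesis
  proof (cases "sup_norm h = \<top> \<or> deriv_sup_norm h = \<top>")
    case True
    then have "(331 * sup_norm h + 167 * deriv_sup_norm h * ennreal ?mx) * ennreal ?r = \<top>"
      using pos by (auto simp: ennreal_mult_eq_top_iff)
    then show ?thesis by simp
  next
    case False
    then obtain B L where B: "sup_norm h = ennreal B" "0 \<le> B" and L: "deriv_sup_norm h = ennreal L" "0 \<le> L"
      by (metis ennreal_cases)
    interpret mallows n q by unfold_locales (use assms in auto)
    have bdd: "\<bar>h t\<bar> \<le> B" for t
    proof -
      have "ennreal \<bar>h t\<bar> \<le> sup_norm h"
        unfolding sup_norm_on_def by (rule SUP_upper) simp
      then show ?thesis using B by simp
    qed
    have deriv: "\<bar>deriv h t\<bar> \<le> L" if "h differentiable (at t)" for t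
    proof -
      have "ennreal \<bar>deriv h t\<bar> \<le> deriv_sup_norm h"
        unfolding sup_norm_on_def by (rule SUP_upper) (use that in simp)
      then show ?thesis using L by simp
    qed
    have lip: "\<bar>h s - h t\<bar> \<le> L * \<bar>s - t\<bar>" for s t
      by (rule piecewise_C1_lipschitz[OF assms(10) deriv L(2)])
    note ex = mallows_distributed_expectation[OF assms(1-4)]
    have \<mu>: "\<mu> = E Y"
      using assms(5) ex[of Y] by (simp add: Y_def)
    have var: "\<sigma>\<^sup>2 = E (\<lambda>v. (Y v - E Y)\<^sup>2)"
      using assms(6) ex[of "\<lambda>v. (Y v - E Y)\<^sup>2"] \<mu> assms(5) by (simp add: Y_def)
    have hM: "prob_space.expectation M (\<lambda>\<omega>. h ((real (des n (w \<omega>) + des n (inv (w \<omega>))) - \<mu>) / \<sigma>)) =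
        E (\<lambda>v. h ((Y v - E Y) / \<sigma>))"
      using ex[of "\<lambda>v. h ((Y v - E Y) / \<sigma>)"] \<mu> by (simp add: Y_def)
    have "h \<in> borel_measurable borel"
    proof (rule borel_measurable_continuous_onI, rule lipschitz_on_continuous_on)
      show "L-lipschitz_on UNIV h"
        using lip L by (auto simp: lipschitz_on_def dist_real_def)
    qed
    then have hN: "prob_space.expectation N (\<lambda>\<omega>. h (Z \<omega>)) = (\<integral>t. \<phi> t * h t \<partial>lborel)"
      using distributed_integral[OF assms(9), of h] by simp
    have "\<bar>E (\<lambda>v. h ((Y v - E Y) / \<sigma>)) - (\<integral>t. \<phi> t * h t \<partial>lborel)\<bar> \<le> (331 * B + 167 * L * ?mx) * ?r"
      by (rule mallows_clt[OF bdd lip var assms(7)])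
    then have "ennreal \<bar>E (\<lambda>v. h ((Y v - E Y) / \<sigma>)) - (\<integral>t. \<phi> t * h t \<partial>lborel)\<bar>
        \<le> ennreal ((331 * B + 167 * L * ?mx) * ?r)"
      by (rule ennreal_leI)
    also have "\<dots> = (331 * ennreal B + 167 * ennreal L * ennreal ?mx) * ennreal ?r"
      using B L pos by (simp add: ennreal_mult ennreal_plus ennreal_numeral[symmetric] del: ennreal_numeral)
    finally show ?thesis
      unfolding hM hN B(1) L(1) .
  qed
qed

end
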